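(* Let $\{G_n\}_{n\ge 1}$ be a sequence of probability distributions on $\mathbb{R}$ such that the functions $\tau_n(\delta)=\log_n \mathbb{P}_{\mu\sim G_n}(|X|>\sqrt{2\delta\log n})$ (where $X\mid\mu\sim N(\mu,1)$) converge uniformly on $\delta\in[0,1]$ as $n\to\infty$. Let $\beta^*$ be the critical sparsity level corresponding to $\{G_n\}$. Suppose that either (A1) $\beta^*>3/4$; or (A2) $\{G_n\}$ is a scale family, $G_n(\mu)=G(\mu/\sigma_n)$ for some distribution function $G$ and some sequence $\sigma_n>0$, where $\theta\mapsto -\max\{\log(1-G(\theta)),\log G(-\theta)\}$ is a regularly varying function with index of regular variation $\gamma\le 2$. If $\beta^*>1/2$, then for every $\alpha\in(0,1)$ the level-$\alpha$ max test has full asymptotic power whenever $\beta<\beta^*$ (with $0<\beta<1$); that is, the probability that the level-$\alpha$ max test rejects under $H_1^n$ with sparsity parameter $\beta$ tends to $1$ as $n\to\infty$.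
   Context: Model. We observe $X_1,\dots,X_n$ where, given $\mu_1,\dots,\mu_n$, the $X_i$ are independent with $X_i\sim N(\mu_i,1)$. Under $H_0^n$, all $\mu_i=0$. Under $H_1^n$ with sparsity parameter $\beta$, the $\mu_i$ are i.i.d. from $(1-\pi_n)\delta_0+\pi_n G_n$ with $\pi_n=n^{-\beta}$, where $\delta_0$ is the point mass at $0$. $G_n$ also denotes the cumulative distribution function. $\log_n$ is the logarithm in base $n$. Total variation. $d_{TV}(Q_1,Q_2)=\sup_A|Q_1(A)-Q_2(A)|$, and $d_{TV}(H_0^n,H_1^n)$ is the total variation distance between the laws of $(X_1,\dots,X_n)$ under $H_0^n$ and $H_1^n$, i.e. between $\Phi^n$ and $((1-\pi_n)\Phi+\pi_n(G_n*\Phi))^n$ ($n$-fold product measures, $\Phi$ the standard normal law). Critical sparsity level. For fixed $\{G_n\}$ let $\underline{\beta}^*=\sup\{\beta\ge 0:\lim_n d_{TV}(H_0^n,H_1^n)=1\}$ and $\bar\beta^*=\inf\{\beta\le 1:\lim_n d_{TV}(H_0^n,H_1^n)=0\}$, where $H_1^n$ has sparsity parameter $\beta$ (conventions: $\sup\emptyset=0$, $\inf\emptyset=1$, and $\beta$ ranges over $[0,1]$). When $\underline{\beta}^*=\bar\beta^*$, the common value $\beta^*$ is called the critical sparsity level corresponding to $\{G_n\}$. Max test. The level-$\alpha$ max test rejects $H_0^n$ when $\max_i|X_i|>m(n,\alpha)$, where $m(n,\alpha)$ is the $1-\alpha$ quantile of $\max_i|X_i|$ under $H_0^n$. Regular variation.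 A function $Q:(0,\infty)\to(0,\infty)$ is regularly varying if $g_Q(t)=\lim_{x\to\infty}Q(tx)/Q(x)$ is finite and nonzero for every $t>0$; then $g_Q(t)=t^\gamma$ for some real $\gamma$, called the index of regular variation. Convention: $\log 0=-\infty$. *)

theory Defs
  imports "HOL-Probability.Probability"
begin

section \<open>The sparse mixture model\<close>

definition std_normal :: "real measure" where
  "std_normal = density lborel (\<lambda>x. ennreal (std_normal_density x))"

text \<open>The mixture \<open>(1 - p) M + p N\<close> of two measures on the same measurable space.\<close>

definition mixture :: "real \<Rightarrow> 'a measure \<Rightarrow> 'a measure \<Rightarrow> 'a measure" where
  "mixture p M N = measure_of (space M) (sets M)
     (\<lambda>A. ennreal (1 - p) * emeasure M A + ennreal p * emeasure N A)"

text \<open>The law of \<open>X\<close> when \<open>\<mu>\<close> has law \<open>P\<close> and \<open>X\<close> given \<open>\<mu>\<close> is \<open>N(\<mu>, 1)\<close>.\<close>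

definition noisy :: "real measure \<Rightarrow> real measure" where
  "noisy P = convolution P std_normal"

definition sparse_prior :: "(nat \<Rightarrow> real measure) \<Rightarrow> real \<Rightarrow> nat \<Rightarrow> real measure" where
  "sparse_prior G \<beta> n = mixture (real n powr (- \<beta>)) (return borel 0) (G n)"

text \<open>The joint laws of \<open>X\<^sub>1, \<dots>, X\<^sub>n\<close> under the null and the alternative hypothesis.\<close>

definition H0 :: "nat \<Rightarrow> (nat \<Rightarrow> real) measure" where
  "H0 n = PiM {1..n} (\<lambda>_. std_normal)"

definition H1 :: "(nat \<Rightarrow> real measure) \<Rightarrow> real \<Rightarrow> nat \<Rightarrow> (nat \<Rightarrow> real) measure" where
  "H1 G \<beta> n = PiM {1..n} (\<lambda>_. noisy (sparse_prior G \<beta> n))"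

lemma space_mixture [simp]: "space (mixture p M N) = space M"
  and sets_mixture [simp, measurable_cong]: "sets (mixture p M N) = sets M"
  unfolding mixture_def by simp_all

lemma emeasure_mixture:
  assumes "sets N = sets M" "A \<in> sets M"
  shows "emeasure (mixture p M N) A = ennreal (1 - p) * emeasure M A + ennreal p * emeasure N A"
  unfolding mixture_def
proof (rule emeasure_measure_of_sigma)
  show "sigma_algebra (space M) (sets M)" by (rule sets.sigma_algebra_axioms)
  show "positive (sets M) (\<lambda>A. ennreal (1 - p) * emeasure M A + ennreal p * emeasure N A)"
    by (simp add: positive_def)
  show "countably_additive (sets M) (\<lambda>A. ennreal (1 - p) * emeasure M A + ennreal p * emeasure N A)"
    unfolding countably_additive_def
  proof (intro allI impI)
    fix F :: "nat \<Rightarrow> _ set" assume F: "range F \<subseteq> sets M" "disjoint_family F"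
    have "(\<Sum>i. ennreal (1 - p) * emeasure M (F i) + ennreal p * emeasure N (F i)) =
      ennreal (1 - p) * (\<Sum>i. emeasure M (F i)) + ennreal p * (\<Sum>i. emeasure N (F i))"
      by (simp add: suminf_add[symmetric])
    then show "(\<Sum>i. ennreal (1 - p) * emeasure M (F i) + ennreal p * emeasure N (F i)) =
      ennreal (1 - p) * emeasure M (\<Union> (range F)) + ennreal p * emeasure N (\<Union> (range F))"
      using F assms by (simp add: suminf_emeasure)
  qed
qed (use assms in auto)

lemma nn_integral_mixture:
  assumes N: "sets N = sets M" and f: "f \<in> borel_measurable M"
  shows "(\<integral>\<^sup>+x. f x \<partial>mixture p M N) = ennreal (1 - p) * (\<integral>\<^sup>+x. f x \<partial>M) + ennreal p * (\<integral>\<^sup>+x. f x \<partial>N)"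
  using f
proof (induction rule: borel_measurable_induct)
  case (cong f g)
  have "space N = space M" using N by (rule sets_eq_imp_space_eq)
  then have "(\<integral>\<^sup>+x. f x \<partial>M) = (\<integral>\<^sup>+x. g x \<partial>M)" "(\<integral>\<^sup>+x. f x \<partial>N) = (\<integral>\<^sup>+x. g x \<partial>N)"
     "(\<integral>\<^sup>+x. f x \<partial>mixture p M N) = (\<integral>\<^sup>+x. g x \<partial>mixture p M N)"
    using cong(3) by (auto intro!: nn_integral_cong)
  then show ?case using cong by simp
next
  case (set A)
  then show ?case using N by (simp add: emeasure_mixture)
next
  case (mult u c)
  note [measurable_cong] = N
  note [measurable] = mult.hyps(2)
  show ?case using mult.IH by (simp add: nn_integral_cmult distrib_left mult.left_commute)
next
  case (add u v)
  note [measurable_cong] = N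
  note [measurable] = add.hyps(1,3)
  show ?case using add.IH by (simp add: nn_integral_add distrib_left ac_simps)
next
  case (seq U)
  note [measurable_cong] = N
  note [measurable] = seq.hyps(1)
  have U: "(\<integral>\<^sup>+x. (SUP i. U i) x \<partial>L) = (SUP i. \<integral>\<^sup>+x. U i x \<partial>L)" if "sets L = sets M" for L
    using that seq.hyps(1,3) by (auto simp: image_comp SUP_apply
        intro!: nn_integral_monotone_convergence_SUP cong: measurable_cong_sets)
  have inc: "incseq (\<lambda>i. c * (\<integral>\<^sup>+x. U i x \<partial>L))" for L and c :: ennreal
    using seq.hyps(3) by (auto simp: incseq_def le_fun_def intro!: mult_left_mono nn_integral_mono)
  show ?case
    using N inc by (simp add: U seq.IH del: SUP_apply Sup_apply add: SUP_mult_left_ennreal ennreal_SUP_add)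
qed

text \<open>The single-coordinate law under the alternative is \<open>(1 - \<pi>\<^sub>n) \<Phi> + \<pi>\<^sub>n (G\<^sub>n * \<Phi>)\<close>.\<close>

lemma noisy_mixture:
  assumes "real_distribution P" "0 \<le> p" "p \<le> 1"
  shows "noisy (mixture p (return borel 0) P) = mixture p std_normal (noisy P)"
proof -
  interpret P: real_distribution P by fact
  interpret D: prob_space "return borel (0::real)" by (rule prob_space_return) simp
  interpret Z: prob_space std_normal
    unfolding std_normal_def by (rule prob_space_normal_density) simp
  have sZ [simp, measurable_cong]: "sets std_normal = sets borel" by (simp add: std_normal_def)
  have spZ [simp]: "space std_normal = UNIV" by (simp add: std_normal_def)
  have mix: "finite_measure (mixture p (return borel 0) P)"
    by (rule finite_measureI)
      (simp add: emeasure_mixture P.emeasure_space_1[simplified] emeasure_return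
        ennreal_plus[symmetric] del: ennreal_plus)
  show ?thesis
  proof (rule measure_eqI)
    show "sets (noisy (mixture p (return borel 0) P)) = sets (mixture p std_normal (noisy P))"
      by (simp add: noisy_def)
  next
    fix A assume "A \<in> sets (noisy (mixture p (return borel 0) P))"
    then have A [measurable]: "A \<in> sets borel" by (simp add: noisy_def)
    have m [measurable]: "(\<lambda>x. emeasure std_normal {a. a + x \<in> A}) \<in> borel_measurable borel"
    proof -
      have "(\<lambda>x. emeasure std_normal (Pair x -` {z \<in> space (borel \<Otimes>\<^sub>M std_normal). snd z + fst z \<in> A})) \<in> borel_measurable borel"
        by (rule Z.measurable_emeasure_Pair) measurable
      then show ?thesis by (simp add: space_pair_measure)
    qed
    have 1: "emeasure (noisy L) A = (\<integral>\<^sup>+x. emeasure std_normal {a. a + x \<in> A} \<partial>L)"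
      if "finite_measure L" "sets L = sets borel" for L
      unfolding noisy_def using that sets_eq_imp_space_eq[OF that(2)]
      by (intro convolution_emeasure) (auto simp: Z.finite_measure)
    show "emeasure (noisy (mixture p (return borel 0) P)) A = emeasure (mixture p std_normal (noisy P)) A"
      using mix P.finite_measure
      by (simp add: 1 nn_integral_mixture emeasure_mixture nn_integral_return noisy_def[symmetric])
        (simp add: emeasure_mixture noisy_def 1[unfolded noisy_def] P.finite_measure)
  qed
qed

section \<open>Total variation and the critical sparsity level\<close>

definition tv_dist :: "'a measure \<Rightarrow> 'a measure \<Rightarrow> real" where
  "tv_dist P Q = (SUP A\<in>sets P. \<bar>measure P A - measure Q A\<bar>)"

definition separable_levels :: "(nat \<Rightarrow> real measure) \<Rightarrow> real set" where
  "separable_levels G = {\<beta>\<in>{0..1}. (\<lambda>n. tv_dist (H0 n) (H1 G \<beta> n)) \<longlonglongrightarrow> 1}"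

definition inseparable_levels :: "(nat \<Rightarrow> real measure) \<Rightarrow> real set" where
  "inseparable_levels G = {\<beta>\<in>{0..1}. (\<lambda>n. tv_dist (H0 n) (H1 G \<beta> n)) \<longlonglongrightarrow> 0}"

definition lower_critical :: "(nat \<Rightarrow> real measure) \<Rightarrow> real" where
  "lower_critical G = (if separable_levels G = {} then 0 else Sup (separable_levels G))"

definition upper_critical :: "(nat \<Rightarrow> real measure) \<Rightarrow> real" where
  "upper_critical G = (if inseparable_levels G = {} then 1 else Inf (inseparable_levels G))"

definition critical_sparsity_level :: "(nat \<Rightarrow> real measure) \<Rightarrow> real \<Rightarrow> bool" where
  "critical_sparsity_level G \<beta>s \<longleftrightarrow> lower_critical G = \<beta>s \<and> upper_critical G = \<beta>s"

section \<open>The max test\<close>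

definition max_abs :: "nat \<Rightarrow> (nat \<Rightarrow> real) \<Rightarrow> real" where
  "max_abs n x = (MAX i\<in>{1..n}. \<bar>x i\<bar>)"

definition quantile :: "real measure \<Rightarrow> real \<Rightarrow> real" where
  "quantile P p = Inf {x. p \<le> cdf P x}"

definition max_test_threshold :: "nat \<Rightarrow> real \<Rightarrow> real" where
  "max_test_threshold n \<alpha> = quantile (distr (H0 n) borel (max_abs n)) (1 - \<alpha>)"

definition max_test_power :: "(nat \<Rightarrow> real measure) \<Rightarrow> real \<Rightarrow> nat \<Rightarrow> real \<Rightarrow> real" where
  "max_test_power G \<beta> n \<alpha> =
     \<P>(x in H1 G \<beta> n. max_abs n x > max_test_threshold n \<alpha>)"

section \<open>Tail exponents and regular variation\<close>

definition tail_exponent :: "(nat \<Rightarrow> real measure) \<Rightarrow> nat \<Rightarrow> real \<Rightarrow> real" where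
  "tail_exponent G n \<delta> =
     log (real n) (\<P>(x in noisy (G n). \<bar>x\<bar> > sqrt (2 * \<delta> * ln (real n))))"

text \<open>
  Functions on \<open>(0, \<infinity>)\<close> are represented by total functions whose values outside \<open>(0, \<infinity>)\<close>
  are irrelevant.
\<close>

definition regularly_varying :: "(real \<Rightarrow> real) \<Rightarrow> bool" where
  "regularly_varying Q \<longleftrightarrow> (\<forall>x>0. Q x > 0) \<and>
     (\<forall>t>0. \<exists>g. g \<noteq> 0 \<and> ((\<lambda>x. Q (t * x) / Q x) \<longlongrightarrow> g) at_top)"

definition regular_variation_index :: "(real \<Rightarrow> real) \<Rightarrow> real \<Rightarrow> bool" where
  "regular_variation_index Q \<gamma> \<longleftrightarrow> (\<forall>t>0. ((\<lambda>x. Q (t * x) / Q x) \<longlongrightarrow> t powr \<gamma>) at_top)"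

text \<open>The library's \<^const>\<open>ln\<close> has \<open>ln 0 = 0\<close>; here \<open>log 0 = -\<infinity>\<close> is needed.\<close>

definition ext_ln :: "real \<Rightarrow> ereal" where
  "ext_ln x = (if x = 0 then - \<infinity> else ereal (ln x))"

definition neg_log_tail :: "real measure \<Rightarrow> real \<Rightarrow> ereal" where
  "neg_log_tail F \<theta> = - max (ext_ln (1 - cdf F \<theta>)) (ext_ln (cdf F (- \<theta>)))"

definition scale_family :: "(nat \<Rightarrow> real measure) \<Rightarrow> real measure \<Rightarrow> (nat \<Rightarrow> real) \<Rightarrow> bool" where
  "scale_family G F \<sigma> \<longleftrightarrow>
     real_distribution F \<and> (\<forall>n\<ge>1. \<sigma> n > 0 \<and> (\<forall>\<mu>. cdf (G n) \<mu> = cdf F (\<mu> / \<sigma> n)))"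

end

theory Submission
  imports Defs
begin

text \<open>
  Let \<open>T = sqrt (2 ln n)\<close> and let \<open>\<tau>\<close> be the limit of the tail exponents at \<open>\<delta> = 1\<close>, so that a
  coordinate drawn from the signal component exceeds \<open>T\<close> with probability \<open>n powr (\<tau> + o(1))\<close>. Under
  the null the maximum stays below \<open>T\<close> with probability tending to one, whereas under the
  alternative the expected number of signals beyond \<open>T\<close> is \<open>n powr (1 - \<beta> + \<tau> + o(1))\<close>. Hence the max
  test has full power for \<open>\<beta> < 1 + \<tau>\<close>, and it remains to see that the total variation distance does
  not tend to one for \<open>\<beta> > 1 + \<tau>\<close>.

  For this, truncate the likelihood ratio \<open>L\<close> of the signal component to \<open>[-T, T]\<close>; the mass lost is
  negligible when \<open>\<beta> > 1 + \<tau>\<close>. By Minkowski's inequality, the truncated \<open>L\<^sup>2\<close> norm of \<open>L\<close> is at most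
  the mean of the norms of the ratios of \<open>N(\<mu>, 1)\<close>, which are \<open>exp (\<mu>\<^sup>2 / 2)\<close> for \<open>\<bar>\<mu>\<bar> \<le> T / 2\<close> and
  \<open>sqrt n * exp (- (T - \<bar>\<mu>\<bar>)\<^sup>2 / 2)\<close> beyond. The second part is bounded by \<open>n powr (1 / 2 + \<tau> + o(1))\<close>, which
  is harmless. The first part is at most \<open>n powr (1 / 4)\<close>, which is harmless for \<open>\<beta> > 3 / 4\<close>; for a scale
  family with \<open>\<gamma> \<le> 2\<close>, regular variation shows that it is dominated by its values at \<open>\<mu> = 0\<close> and
  \<open>\<bar>\<mu>\<bar> = T / 2\<close>, the latter being controlled by \<open>\<tau>\<close> again.
\<close>

section \<open>Total variation between product measures\<close>

text \<open>A product measure is determined by its values on boxes. There the product density times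
  the indicator of the box factors over the coordinates.\<close>

lemma PiM_density:
  assumes "finite I" "prob_space M" "prob_space (density M f)" and [measurable]: "f \<in> borel_measurable M"
  shows "PiM I (\<lambda>_. density M f) = density (PiM I (\<lambda>_. M)) (\<lambda>x. \<Prod>i\<in>I. f (x i))"
proof -
  interpret M: prob_space M by fact
  interpret N: prob_space "density M f" by fact
  interpret PM: product_sigma_finite "\<lambda>_. M" by standard
  interpret PN: product_sigma_finite "\<lambda>_. density M f" by standard
  show ?thesis
  proof (rule PN.PiM_eqI[OF assms(1), symmetric])
    show "sets (density (PiM I (\<lambda>_. M)) (\<lambda>x. \<Prod>i\<in>I. f (x i))) = sets (PiM I (\<lambda>_. density M f))"
      by (simp cong: sets_PiM_cong)
    fix A assume "\<And>i. i \<in> I \<Longrightarrow> A i \<in> sets (density M f)"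
    then have A [measurable]: "\<And>i. i \<in> I \<Longrightarrow> A i \<in> sets M" by simp
    have "emeasure (density (PiM I (\<lambda>_. M)) (\<lambda>x. \<Prod>i\<in>I. f (x i))) (Pi\<^sub>E I A) =
        (\<integral>\<^sup>+x. (\<Prod>i\<in>I. f (x i)) * indicator (Pi\<^sub>E I A) x \<partial>PiM I (\<lambda>_. M))"
      using assms(1) by (intro emeasure_density) (auto intro!: sets_PiM_I_finite)
    also have "\<dots> = (\<integral>\<^sup>+x. (\<Prod>i\<in>I. f (x i) * indicator (A i) (x i)) \<partial>PiM I (\<lambda>_. M))"
    proof (rule nn_integral_cong)
      fix x assume x: "x \<in> space (PiM I (\<lambda>_. M))"
      have "indicator (Pi\<^sub>E I A) x = (\<Prod>i\<in>I. indicator (A i) (x i) :: ennreal)"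
        using x assms(1) by (auto simp: space_PiM PiE_iff prod_zero_iff split: split_indicator)
      then show "(\<Prod>i\<in>I. f (x i)) * indicator (Pi\<^sub>E I A) x = (\<Prod>i\<in>I. f (x i) * indicator (A i) (x i))"
        by (simp add: prod.distrib)
    qed
    also have "\<dots> = (\<Prod>i\<in>I. \<integral>\<^sup>+x. f x * indicator (A i) x \<partial>M)"
      using assms(1) by (intro PM.product_nn_integral_prod) auto
    also have "\<dots> = (\<Prod>i\<in>I. emeasure (density M f) (A i))"
      using A by (intro prod.cong refl) (simp add: emeasure_density)
    finally show "emeasure (density (PiM I (\<lambda>_. M)) (\<lambda>x. \<Prod>i\<in>I. f (x i))) (Pi\<^sub>E I A) =
        (\<Prod>i\<in>I. emeasure (density M f) (A i))" .
  qed
qed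

text \<open>
  A minorant \<open>f\<close> of the likelihood ratio suffices: discarding mass only lowers the right-hand
  measure of an event, and complementing the event reverses the sign of the difference.
\<close>

lemma tv_dist_PiM_density_le:
  fixes f :: "'a \<Rightarrow> real"
  assumes I: "finite I" and M: "prob_space M" and N: "prob_space (density M l)"
    and [measurable]: "l \<in> borel_measurable M" "f \<in> borel_measurable M"
    and f: "\<And>x. 0 \<le> f x" "\<And>x. f x \<le> C" "\<And>x. x \<in> space M \<Longrightarrow> ennreal (f x) \<le> l x"
  shows "tv_dist (PiM I (\<lambda>_. M)) (PiM I (\<lambda>_. density M l)) \<le>
     sqrt ((\<integral>x. (f x)\<^sup>2 \<partial>M) ^ card I - 2 * (\<integral>x. f x \<partial>M) ^ card I + 1)"
    (is "_ \<le> sqrt ?V")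
proof -
  interpret M: prob_space M by fact
  interpret N: prob_space "density M l" by fact
  interpret PM: product_sigma_finite "\<lambda>_. M" by standard
  let ?P = "PiM I (\<lambda>_. M)" and ?Q = "PiM I (\<lambda>_. density M l)"
  interpret P: prob_space ?P by (rule prob_space_PiM) (rule M)
  interpret Q: prob_space ?Q by (rule prob_space_PiM) (rule N)
  define Z where "Z x = (\<Prod>i\<in>I. f (x i))" for x :: "'b \<Rightarrow> 'a"
  have [measurable]: "Z \<in> borel_measurable ?P"
    unfolding Z_def using I by measurable
  have Z0: "0 \<le> Z x" for x unfolding Z_def by (simp add: prod_nonneg f)
  have if1: "integrable M f"
    using f by (intro M.integrable_const_bound[where B = C]) (auto simp: abs_of_nonneg)
  have if2: "integrable M (\<lambda>x. (f x)\<^sup>2)"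
    using f by (intro M.integrable_const_bound[where B = "C\<^sup>2"]) (auto simp: abs_of_nonneg power_mono)
  have iZ: "integrable ?P Z"
    unfolding Z_def using I if1 by (intro PM.product_integrable_prod) auto
  have eZ: "P.expectation Z = (\<integral>x. f x \<partial>M) ^ card I"
    unfolding Z_def using I if1 by (subst PM.product_integral_prod) auto
  have Z2: "(Z x)\<^sup>2 = (\<Prod>i\<in>I. (f (x i))\<^sup>2)" for x
    unfolding Z_def by (simp add: prod_power_distrib)
  have iZ2: "integrable ?P (\<lambda>x. (Z x)\<^sup>2)"
    unfolding Z2 using I if2 by (intro PM.product_integrable_prod) auto
  have eZ2: "P.expectation (\<lambda>x. (Z x)\<^sup>2) = (\<integral>x. (f x)\<^sup>2 \<partial>M) ^ card I"
    unfolding Z2 using I if2 by (subst PM.product_integral_prod) auto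
  \<comment> \<open>\<open>P.expectation Y\<close> dominates the integral of \<open>1 - Z\<close>
    over any event. The variance of \<open>Y\<close> being nonnegative bounds it by the root of the
    second moment, which factors over the coordinates.\<close>
  define Y where "Y x = \<bar>Z x - 1\<bar>" for x
  have Ysq: "(Y x)\<^sup>2 = (Z x)\<^sup>2 - 2 * Z x + 1" for x
    by (simp add: Y_def power2_eq_square algebra_simps)
  have iY: "integrable ?P Y" unfolding Y_def using iZ by simp
  have iY2: "integrable ?P (\<lambda>x. (Y x)\<^sup>2)" unfolding Ysq using iZ iZ2 by simp
  have eY2: "P.expectation (\<lambda>x. (Y x)\<^sup>2) = ?V"
    unfolding Ysq using iZ iZ2 by (simp add: eZ eZ2 P.prob_space)
  have "0 \<le> P.variance Y" by (rule P.variance_positive)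
  then have "(P.expectation Y)\<^sup>2 \<le> ?V" using iY iY2 by (simp add: P.variance_eq eY2)
  then have EY: "P.expectation Y \<le> sqrt ?V" by (rule real_le_rsqrt)
  have Qd: "?Q = density ?P (\<lambda>x. \<Prod>i\<in>I. l (x i))"
    using I M N by (intro PiM_density) auto
  have ZQ: "ennreal (Z x) \<le> (\<Prod>i\<in>I. l (x i))" if "x \<in> space ?P" for x
  proof -
    have "ennreal (Z x) = (\<Prod>i\<in>I. ennreal (f (x i)))" unfolding Z_def by (simp add: prod_ennreal f)
    also have "\<dots> \<le> (\<Prod>i\<in>I. l (x i))"
      using that by (intro prod_mono_ennreal f) (auto simp: space_PiM)
    finally show ?thesis .
  qed
  have one_sided: "measure ?P E - measure ?Q E \<le> sqrt ?V" if E [measurable]: "E \<in> sets ?P" for E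
  proof -
    have iZE: "integrable ?P (\<lambda>x. Z x * indicator E x)"
      using iZ by (rule integrable_real_mult_indicator[OF E])
    have "ennreal (\<integral>x. Z x * indicator E x \<partial>?P) = (\<integral>\<^sup>+x. ennreal (Z x * indicator E x) \<partial>?P)"
      using iZE Z0 by (intro nn_integral_eq_integral[symmetric]) auto
    also have "\<dots> \<le> (\<integral>\<^sup>+x. (\<Prod>i\<in>I. l (x i)) * indicator E x \<partial>?P)"
      using ZQ by (intro nn_integral_mono) (auto split: split_indicator)
    also have "\<dots> = emeasure ?Q E"
      unfolding Qd by (rule emeasure_density[symmetric]) (use I in measurable)
    finally have "(\<integral>x. Z x * indicator E x \<partial>?P) \<le> measure ?Q E"
      by (simp add: Q.emeasure_eq_measure)
    moreover have "measure ?P E - (\<integral>x. Z x * indicator E x \<partial>?P) = (\<integral>x. indicator E x - Z x * indicator E x \<partial>?P)"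
      using iZE by (subst Bochner_Integration.integral_diff) (auto simp: P.emeasure_eq_measure)
    moreover have "\<dots> \<le> P.expectation Y"
      using iZE iY by (intro integral_mono) (auto simp: Y_def P.emeasure_eq_measure split: split_indicator)
    ultimately show ?thesis using EY by linarith
  qed
  have sets_eq: "sets ?Q = sets ?P" by (simp cong: sets_PiM_cong)
  have "\<bar>measure ?P E - measure ?Q E\<bar> \<le> sqrt ?V" if E: "E \<in> sets ?P" for E
  proof -
    have "measure ?P (space ?P - E) - measure ?Q (space ?P - E) \<le> sqrt ?V"
      using E by (intro one_sided) auto
    moreover have "measure ?Q (space ?P - E) = 1 - measure ?Q E"
      using Q.prob_compl[of E] E sets_eq sets_eq_imp_space_eq[OF sets_eq] by simp
    ultimately show ?thesis using one_sided[OF E] P.prob_compl[OF E] by simp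
  qed
  moreover have "sets ?P \<noteq> {}" by auto
  ultimately show ?thesis unfolding tv_dist_def by (intro cSUP_least) auto
qed

section \<open>Gaussian shifts and tails\<close>

lemma sets_std_normal [simp, measurable_cong]: "sets std_normal = sets borel"
  and space_std_normal [simp]: "space std_normal = UNIV"
  by (simp_all add: std_normal_def)

lemma prob_space_std_normal: "prob_space std_normal"
  unfolding std_normal_def by (rule prob_space_normal_density) simp

lemma nn_integral_std_normal:
  assumes [measurable]: "f \<in> borel_measurable borel"
  shows "(\<integral>\<^sup>+x. f x \<partial>std_normal) = (\<integral>\<^sup>+x. ennreal (std_normal_density x) * f x \<partial>lborel)"
  unfolding std_normal_def by (rule nn_integral_density) simp_all

lemma std_normal_density_shift:
  "std_normal_density (x - \<mu>) = std_normal_density x * exp (\<mu> * x - \<mu>\<^sup>2 / 2)"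
  unfolding std_normal_density_def
  by (simp add: exp_add[symmetric] power2_eq_square field_simps)

lemma nn_integral_std_normal_shift:
  assumes [measurable]: "f \<in> borel_measurable borel"
  shows "(\<integral>\<^sup>+x. f (\<mu> + x) \<partial>std_normal) = (\<integral>\<^sup>+x. ennreal (exp (\<mu> * x - \<mu>\<^sup>2 / 2)) * f x \<partial>std_normal)"
proof -
  have "(\<integral>\<^sup>+x. f (\<mu> + x) \<partial>std_normal) = (\<integral>\<^sup>+x. ennreal (std_normal_density x) * f (\<mu> + x) \<partial>lborel)"
    by (rule nn_integral_std_normal) measurable
  also have "\<dots> = (\<integral>\<^sup>+x. ennreal (std_normal_density (x - \<mu>)) * f x \<partial>lborel)"
    by (subst nn_integral_real_affine[where c = 1 and t = "\<mu>" and f = "\<lambda>x. ennreal (std_normal_density (x - \<mu>)) * f x"]) simp_all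
  also have "\<dots> = (\<integral>\<^sup>+x. ennreal (std_normal_density x) * (ennreal (exp (\<mu> * x - \<mu>\<^sup>2 / 2)) * f x) \<partial>lborel)"
    by (simp add: std_normal_density_shift ennreal_mult mult.assoc)
  also have "\<dots> = (\<integral>\<^sup>+x. ennreal (exp (\<mu> * x - \<mu>\<^sup>2 / 2)) * f x \<partial>std_normal)"
    by (rule nn_integral_std_normal[symmetric]) measurable
  finally show ?thesis .
qed

text \<open>The shift formula for the constant function 1 says that the density of a shifted
  Gaussian has total mass 1; the factor free of \<open>x\<close> is then moved to the other
  side.\<close>

lemma nn_integral_exp_std_normal: "(\<integral>\<^sup>+x. ennreal (exp (a * x)) \<partial>std_normal) = ennreal (exp (a\<^sup>2 / 2))"
proof -
  interpret prob_space std_normal by (rule prob_space_std_normal)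
  have "(\<integral>\<^sup>+x. ennreal (exp (a * x - a\<^sup>2 / 2)) \<partial>std_normal) = 1"
    using nn_integral_std_normal_shift[of "\<lambda>_. 1" a] emeasure_space_1 by simp
  moreover have "(\<integral>\<^sup>+x. ennreal (exp (a * x)) \<partial>std_normal) =
      (\<integral>\<^sup>+x. ennreal (exp (a\<^sup>2 / 2)) * ennreal (exp (a * x - a\<^sup>2 / 2)) \<partial>std_normal)"
    by (simp add: ennreal_mult[symmetric] exp_add[symmetric])
  ultimately show ?thesis by (simp add: nn_integral_cmult)
qed

section \<open>Likelihood ratio of the signal component against the null\<close>

definition lik_ratio :: "real measure \<Rightarrow> real \<Rightarrow> ennreal" where
  "lik_ratio P x = (\<integral>\<^sup>+\<mu>. ennreal (exp (\<mu> * x - \<mu>\<^sup>2 / 2)) \<partial>P)"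

lemma measurable_lik_ratio [measurable]:
  assumes "real_distribution P"
  shows "lik_ratio P \<in> borel_measurable borel"
proof -
  interpret P: real_distribution P by fact
  show ?thesis unfolding lik_ratio_def[abs_def] by measurable
qed

text \<open>The exponent is largest at \<mu> = x. The bound makes the ratio finite everywhere and
  bounded on compact intervals, so that the truncated ratio has all moments.\<close>

lemma lik_ratio_le:
  assumes "real_distribution P"
  shows "lik_ratio P x \<le> ennreal (exp (x\<^sup>2 / 2))"
proof -
  interpret P: real_distribution P by fact
  have "\<mu> * x - \<mu>\<^sup>2 / 2 \<le> x\<^sup>2 / 2" for \<mu>
    using zero_le_power2[of "\<mu> - x"] by (simp add: power2_diff algebra_simps)
  then have "lik_ratio P x \<le> (\<integral>\<^sup>+\<mu>. ennreal (exp (x\<^sup>2 / 2)) \<partial>P)"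
    unfolding lik_ratio_def by (intro nn_integral_mono ennreal_leI) simp
  then show ?thesis using P.emeasure_space_1 by simp
qed

lemma sets_noisy [simp, measurable_cong]: "sets (noisy P) = sets borel"
  and space_noisy [simp]: "space (noisy P) = UNIV"
  by (simp_all add: noisy_def)

lemma nn_integral_noisy:
  assumes "real_distribution P" and [measurable]: "f \<in> borel_measurable borel"
  shows "(\<integral>\<^sup>+x. f x \<partial>noisy P) = (\<integral>\<^sup>+\<mu>. \<integral>\<^sup>+x. f (\<mu> + x) \<partial>std_normal \<partial>P)"
proof -
  interpret P: real_distribution P by fact
  interpret Z: prob_space std_normal by (rule prob_space_std_normal)
  show ?thesis
    unfolding noisy_def by (intro nn_integral_convolution) (simp_all add: P.finite_measure Z.finite_measure)
qed

lemma real_distribution_noisy: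
  assumes "real_distribution P"
  shows "real_distribution (noisy P)"
proof -
  interpret P: real_distribution P by fact
  interpret Z: prob_space std_normal by (rule prob_space_std_normal)
  have "(\<integral>\<^sup>+x. 1 \<partial>noisy P) = 1"
    using assms by (subst nn_integral_noisy) (simp_all add: P.emeasure_space_1[simplified] Z.emeasure_space_1[simplified])
  then have "prob_space (noisy P)" by (intro prob_spaceI) simp
  then show ?thesis by (simp add: real_distribution_def real_distribution_axioms_def)
qed

lemma noisy_eq_density:
  assumes P: "real_distribution P"
  shows "noisy P = density std_normal (lik_ratio P)"
proof (rule measure_eqI)
  interpret P: real_distribution P by fact
  interpret Z: prob_space std_normal by (rule prob_space_std_normal)
  interpret pair_sigma_finite P std_normal ..
  note [measurable] = measurable_lik_ratio[OF P]
  fix A assume "A \<in> sets (noisy P)"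
  then have A [measurable]: "A \<in> sets borel" by simp
  have "emeasure (noisy P) A = (\<integral>\<^sup>+x. indicator A x \<partial>noisy P)" by simp
  also have "\<dots> = (\<integral>\<^sup>+\<mu>. \<integral>\<^sup>+x. indicator A (\<mu> + x) \<partial>std_normal \<partial>P)"
    by (rule nn_integral_noisy[OF P]) measurable
  also have "\<dots> = (\<integral>\<^sup>+\<mu>. \<integral>\<^sup>+x. ennreal (exp (\<mu> * x - \<mu>\<^sup>2 / 2)) * indicator A x \<partial>std_normal \<partial>P)"
    by (subst nn_integral_std_normal_shift) simp_all
  also have "\<dots> = (\<integral>\<^sup>+x. \<integral>\<^sup>+\<mu>. ennreal (exp (\<mu> * x - \<mu>\<^sup>2 / 2)) * indicator A x \<partial>P \<partial>std_normal)"
    by (rule Fubini'[symmetric]) measurable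
  also have "\<dots> = (\<integral>\<^sup>+x. lik_ratio P x * indicator A x \<partial>std_normal)"
    unfolding lik_ratio_def by (intro nn_integral_cong nn_integral_multc) measurable
  also have "\<dots> = emeasure (density std_normal (lik_ratio P)) A"
    by (rule emeasure_density[symmetric]) simp_all
  finally show "emeasure (noisy P) A = emeasure (density std_normal (lik_ratio P)) A" .
qed simp

lemma mixture_density:
  assumes [measurable]: "f \<in> borel_measurable M"
  shows "mixture p M (density M f) = density M (\<lambda>x. ennreal (1 - p) + ennreal p * f x)"
proof (rule measure_eqI)
  fix A assume "A \<in> sets (mixture p M (density M f))"
  then have A [measurable]: "A \<in> sets M" by simp
  have "emeasure (density M (\<lambda>x. ennreal (1 - p) + ennreal p * f x)) A =
     (\<integral>\<^sup>+x. ennreal (1 - p) * indicator A x + ennreal p * (f x * indicator A x) \<partial>M)"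
    by (subst emeasure_density) (auto simp: distrib_right mult.assoc)
  also have "\<dots> = ennreal (1 - p) * emeasure M A + ennreal p * emeasure (density M f) A"
    by (simp add: nn_integral_add nn_integral_cmult emeasure_density)
  finally show "emeasure (mixture p M (density M f)) A = emeasure (density M (\<lambda>x. ennreal (1 - p) + ennreal p * f x)) A"
    by (simp add: emeasure_mixture)
qed simp

lemma noisy_mixture_eq_density:
  assumes "real_distribution P" "0 \<le> p" "p \<le> 1"
  shows "noisy (mixture p (return borel 0) P) =
    density std_normal (\<lambda>x. ennreal (1 - p) + ennreal p * lik_ratio P x)"
  using assms measurable_lik_ratio[OF assms(1)]
  by (simp add: noisy_mixture noisy_eq_density mixture_density)

lemma real_distribution_return: "real_distribution (return borel (a::real))"
  by (auto simp: real_distribution_def real_distribution_axioms_def intro!: prob_space_return)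

lemma real_distribution_mixture:
  assumes "real_distribution M" "real_distribution N" "0 \<le> p" "p \<le> 1"
  shows "real_distribution (mixture p M N)"
proof -
  interpret M: real_distribution M by fact
  interpret N: real_distribution N by fact
  have "prob_space (mixture p M N)"
    using assms M.emeasure_space_1 N.emeasure_space_1
    by (intro prob_spaceI) (simp add: emeasure_mixture ennreal_plus[symmetric] del: ennreal_plus)
  then show ?thesis by (simp add: real_distribution_def real_distribution_axioms_def)
qed

text \<open>Comparing \<open>\<phi>\<close> with \<open>(x / T) \<phi>\<close> gives Mills' bound.\<close>

lemma std_normal_tail_le:
  assumes "T > 0"
  shows "measure std_normal {x. \<bar>x\<bar> > T} \<le> exp (- T\<^sup>2 / 2) / T"
proof -
  interpret prob_space std_normal by (rule prob_space_std_normal)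
  have half: "emeasure std_normal {T..} \<le> ennreal (exp (- T\<^sup>2 / 2) / (T * sqrt (2 * pi)))" (is "_ \<le> ennreal ?r")
  proof -
    have "emeasure std_normal {T..} = (\<integral>\<^sup>+x. ennreal (std_normal_density x) * indicator {T..} x \<partial>lborel)"
      using nn_integral_std_normal[of "indicator {T..}"] by simp
    also have "\<dots> \<le> (\<integral>\<^sup>+x. ennreal (x * std_normal_density x / T) * indicator {T..} x \<partial>lborel)"
      using assms by (intro nn_integral_mono)
        (auto split: split_indicator intro!: ennreal_leI simp: field_simps mult_right_mono)
    also have "\<dots> = ennreal (0 - - std_normal_density T / T)"
    proof (rule nn_integral_FTC_atLeast[where F = "\<lambda>x. - std_normal_density x / T"])
      show "((\<lambda>x. - std_normal_density x / T) has_real_derivative x * std_normal_density x / T) (at x)" for x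
        using assms unfolding std_normal_density_def by (auto intro!: derivative_eq_intros simp: field_simps)
      have "filterlim (\<lambda>x::real. - x\<^sup>2 / 2) at_bot at_top"
        by real_asymp
      then have "((\<lambda>x::real. exp (- x\<^sup>2 / 2)) \<longlongrightarrow> 0) at_top"
        by (rule filterlim_compose[OF exp_at_bot])
      from tendsto_mult_right[OF this, of "- 1 / sqrt (2 * pi) / T"]
      show "((\<lambda>x. - std_normal_density x / T) \<longlongrightarrow> 0) at_top"
        unfolding std_normal_density_def by (simp add: field_simps)
    qed (use assms in auto)
    also have "0 - - std_normal_density T / T = ?r"
      by (simp add: std_normal_density_def)
    finally show ?thesis .
  qed
  have refl: "emeasure std_normal {..- T} = emeasure std_normal {T..}"
  proof -
    have "(\<integral>\<^sup>+x. ennreal (std_normal_density x) * indicator {T..} x \<partial>lborel) =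
        (\<integral>\<^sup>+x. ennreal (std_normal_density x) * indicator {..- T} x \<partial>lborel)"
      by (subst nn_integral_real_affine[where c = "-1" and t = 0])
        (auto intro!: nn_integral_cong simp: std_normal_density_def split: split_indicator)
    then show ?thesis
      using nn_integral_std_normal[of "indicator {T..}"] nn_integral_std_normal[of "indicator {..- T}"] by simp
  qed
  have r0: "0 \<le> ?r" using assms by simp
  have "measure std_normal {x. \<bar>x\<bar> > T} \<le> measure std_normal ({T..} \<union> {..- T})"
    by (intro finite_measure_mono) (use assms in auto)
  also have "\<dots> \<le> measure std_normal {T..} + measure std_normal {..- T}"
    by (rule measure_Un_le) auto
  also have "\<dots> \<le> 2 * ?r"
    using half refl r0 by (simp add: emeasure_eq_measure)
  also have "\<dots> \<le> exp (- T\<^sup>2 / 2) / T"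
  proof -
    have "2 \<le> sqrt (2 * pi)" using pi_gt3 by (intro real_le_rsqrt) simp
    then show ?thesis using assms by (simp add: field_simps)
  qed
  finally show ?thesis .
qed

text \<open>With a = max 0 (T - |\<mu>|), the event contains an interval of length 1 / T starting at
  distance a from 0, on the side of the sign of \<mu>. Since a \<le> T and T \<ge> 1, the squared
  distance grows by at most 3 along it, whence the factor \<open>exp (- 3 / 2)\<close>.\<close>

lemma std_normal_shifted_tail_ge:
  assumes T: "T \<ge> 1"
  shows "measure std_normal {x. \<bar>\<mu> + x\<bar> > T} \<ge> exp (- 3 / 2) / sqrt (2 * pi) / T * exp (- (max 0 (T - \<bar>\<mu>\<bar>))\<^sup>2 / 2)"
proof -
  interpret prob_space std_normal by (rule prob_space_std_normal)
  have interval: "exp (- 3 / 2) / sqrt (2 * pi) / T * exp (- a\<^sup>2 / 2) \<le> measure std_normal S"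
    if a: "0 \<le> a" "a \<le> T" and S: "S \<in> sets borel" "(\<forall>x. a < x \<longrightarrow> x < a + 1 / T \<longrightarrow> x \<in> S) \<or> (\<forall>x. - (a + 1 / T) < x \<longrightarrow> x < - a \<longrightarrow> x \<in> S)"
    for a S
  proof -
    define r where "r = exp (- 3 / 2) / sqrt (2 * pi) * exp (- a\<^sup>2 / 2)"
    have r: "r \<le> std_normal_density x" if x: "\<bar>x\<bar> \<le> a + 1 / T" for x
    proof -
      have "x\<^sup>2 \<le> (a + 1 / T)\<^sup>2"
        using power_mono[OF x, of 2] by simp
      also have "\<dots> = a\<^sup>2 + 2 * (a / T) + 1 / T\<^sup>2" by (simp add: power2_sum power_divide)
      also have "\<dots> \<le> a\<^sup>2 + 2 * 1 + 1"
        using a T by (intro add_mono mult_left_mono) (auto simp: divide_simps one_le_power)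
      finally have "- 3 / 2 - a\<^sup>2 / 2 \<le> - x\<^sup>2 / 2" by simp
      then have "exp (- 3 / 2) * exp (- a\<^sup>2 / 2) \<le> exp (- x\<^sup>2 / 2)"
        by (simp add: exp_add[symmetric])
      then show ?thesis unfolding r_def std_normal_density_def by (simp add: divide_right_mono)
    qed
    obtain J where J: "J \<subseteq> S" "J \<in> sets borel" "emeasure lborel J = ennreal (1 / T)" "\<And>x. x \<in> J \<Longrightarrow> \<bar>x\<bar> \<le> a + 1 / T"
    proof (cases "\<forall>x. a < x \<longrightarrow> x < a + 1 / T \<longrightarrow> x \<in> S")
      case True
      then show ?thesis using T a by (intro that[of "{a<..<a + 1 / T}"]) auto
    next
      case False
      then have "\<forall>x. - (a + 1 / T) < x \<longrightarrow> x < - a \<longrightarrow> x \<in> S" using S(2) by blast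
      then show ?thesis using T a by (intro that[of "{- (a + 1 / T)<..<- a}"]) auto
    qed
    have r0: "0 \<le> r" by (simp add: r_def)
    have "ennreal (r / T) = ennreal r * emeasure lborel J"
      using r0 T J by (simp add: ennreal_mult[symmetric])
    also have "\<dots> = (\<integral>\<^sup>+x. ennreal r * indicator J x \<partial>lborel)"
      using J by (simp add: nn_integral_cmult)
    also have "\<dots> \<le> (\<integral>\<^sup>+x. ennreal (std_normal_density x) * indicator S x \<partial>lborel)"
      using J r by (intro nn_integral_mono) (auto split: split_indicator intro!: ennreal_leI)
    also have "\<dots> = emeasure std_normal S"
      using nn_integral_std_normal[of "indicator S"] S(1) by simp
    finally show ?thesis
      using r0 T by (simp add: emeasure_eq_measure r_def)
  qed
  show ?thesis
    by (rule interval) (use T in auto)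
qed

section \<open>The truncated second moment\<close>

text \<open>
  An upper bound for the \<open>L\<^sup>2(\<Phi>)\<close> norm of the likelihood ratio \<open>exp (\<mu> x - \<mu>\<^sup>2 / 2)\<close> of
  \<open>N(\<mu>, 1)\<close> truncated to \<open>[-T, T]\<close>. The truncation only matters when the mean \<open>2 \<mu>\<close> of the
  squared ratio lies outside of \<open>[-T, T]\<close>.
\<close>

definition truncated_norm :: "real \<Rightarrow> real \<Rightarrow> real" where
  "truncated_norm T \<mu> = (if \<bar>\<mu>\<bar> \<le> T / 2 then exp (\<mu>\<^sup>2 / 2) else exp (T\<^sup>2 / 4 - (T - \<bar>\<mu>\<bar>)\<^sup>2 / 2))"

lemma measurable_truncated_norm [measurable]: "truncated_norm T \<in> borel_measurable borel"
  unfolding truncated_norm_def[abs_def] by measurable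

lemma truncated_norm_pos: "0 < truncated_norm T \<mu>"
  by (simp add: truncated_norm_def)

lemma truncated_norm_bound:
  "(\<integral>\<^sup>+x. ennreal ((exp (\<mu> * x - \<mu>\<^sup>2 / 2))\<^sup>2) * indicator {-T..T} x \<partial>std_normal) \<le> ennreal ((truncated_norm T \<mu>)\<^sup>2)"
proof -
  \<comment> \<open>A linear majorant \<open>a * x + d\<close> of the exponent on the interval
    reduces the integral to a Gaussian exponential moment, equal to
    \<open>exp (a\<^sup>2 / 2 + d)\<close>.\<close>
  have "\<exists>a d. a\<^sup>2 / 2 + d \<le> 2 * ln (truncated_norm T \<mu>) \<and> (\<forall>x\<in>{-T..T}. 2 * (\<mu> * x - \<mu>\<^sup>2 / 2) \<le> a * x + d)"
  proof (cases "\<bar>\<mu>\<bar> \<le> T / 2")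
    case True
    then show ?thesis
      by (intro exI[of _ "2 * \<mu>"] exI[of _ "- \<mu>\<^sup>2"]) (simp add: truncated_norm_def power2_eq_square algebra_simps)
  next
    case False
    define s where "s = sgn \<mu>"
    have s: "s * s = 1" "\<mu> = s * \<bar>\<mu>\<bar>" "\<bar>s\<bar> = 1" if "T \<ge> 0"
      using False that by (auto simp: s_def sgn_if)
    show ?thesis
    proof (cases "T \<ge> 0")
      case True
      define m where "m = \<bar>\<mu>\<bar>"
      have mu: "\<mu> = s * m" and ss: "s * s = 1" using s[OF True] by (simp_all add: m_def)
      \<comment> \<open>The slope \<open>2 * m\<close> in direction \<open>s\<close> is lowered to
        \<open>T\<close>, which moves the mean of the tilted Gaussian back to the end point
        \<open>s * T\<close>. The remaining slope \<open>2 * m - T\<close> is positive, so its term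
        is largest at that end point.\<close>
      have "2 * (\<mu> * x - \<mu>\<^sup>2 / 2) \<le> (s * T) * x + ((2 * m - T) * T - m\<^sup>2)" if x: "x \<in> {-T..T}" for x
      proof -
        have "s * x \<le> \<bar>s * x\<bar>" by simp
        also have "\<dots> \<le> T" using x s(3)[OF True] by (simp add: abs_mult abs_le_iff)
        finally have "(2 * m - T) * (s * x) \<le> (2 * m - T) * T"
          using False by (intro mult_left_mono) (auto simp: m_def)
        moreover have "2 * (\<mu> * x - \<mu>\<^sup>2 / 2) = 2 * m * (s * x) - m\<^sup>2"
          unfolding mu power_mult_distrib by (simp add: power2_eq_square[of s] ss)
        ultimately show ?thesis by (simp add: algebra_simps)
      qed
      moreover have "(s * T)\<^sup>2 / 2 + ((2 * m - T) * T - m\<^sup>2) \<le> 2 * ln (truncated_norm T \<mu>)"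
      proof -
        have sq: "(s * T)\<^sup>2 = T\<^sup>2"
          using ss by (simp add: power_mult_distrib power2_eq_square)
        have ln: "2 * ln (truncated_norm T \<mu>) = T\<^sup>2 / 2 - (T - m)\<^sup>2"
          using False by (simp add: truncated_norm_def m_def)
        show ?thesis unfolding sq ln by (simp add: power2_eq_square algebra_simps)
      qed
      ultimately show ?thesis by blast
    next
      case False
      \<comment> \<open>For T < 0 the interval is empty, so only the first inequality constrains the
        witnesses.\<close>
      then show ?thesis
        by (intro exI[of _ 0] exI[of _ "2 * ln (truncated_norm T \<mu>)"]) auto
    qed
  qed
  then obtain a d where d: "a\<^sup>2 / 2 + d \<le> 2 * ln (truncated_norm T \<mu>)"
    and bound: "\<And>x. x \<in> {-T..T} \<Longrightarrow> 2 * (\<mu> * x - \<mu>\<^sup>2 / 2) \<le> a * x + d" by blast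
  have "(exp (\<mu> * x - \<mu>\<^sup>2 / 2))\<^sup>2 \<le> exp d * exp (a * x)" if "x \<in> {-T..T}" for x
    using bound[OF that] by (simp add: exp_double[symmetric] exp_add[symmetric])
  then have "(\<integral>\<^sup>+x. ennreal ((exp (\<mu> * x - \<mu>\<^sup>2 / 2))\<^sup>2) * indicator {-T..T} x \<partial>std_normal) \<le>
      (\<integral>\<^sup>+x. ennreal (exp d) * ennreal (exp (a * x)) \<partial>std_normal)"
    by (intro nn_integral_mono) (auto split: split_indicator simp: ennreal_mult[symmetric] intro!: ennreal_leI)
  also have "\<dots> = ennreal (exp d) * ennreal (exp (a\<^sup>2 / 2))"
    by (subst nn_integral_cmult) (simp_all add: nn_integral_exp_std_normal)
  also have "\<dots> = ennreal (exp (a\<^sup>2 / 2 + d))"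
    by (simp add: ennreal_mult[symmetric] exp_add[symmetric] add.commute)
  also have "\<dots> \<le> ennreal (exp (2 * ln (truncated_norm T \<mu>)))"
    using d by (intro ennreal_leI) simp
  also have "\<dots> = ennreal ((truncated_norm T \<mu>)\<^sup>2)"
    using truncated_norm_pos[of T \<mu>] by (simp add: exp_double)
  finally show ?thesis .
qed

text \<open>Minkowski's inequality, in the form of the Cauchy-Schwarz inequality weighted by the norms.\<close>

lemma lik_ratio_second_moment:
  assumes P: "real_distribution P"
  shows "(\<integral>\<^sup>+x. (lik_ratio P x)\<^sup>2 * indicator {-T..T} x \<partial>std_normal) \<le> (\<integral>\<^sup>+\<mu>. truncated_norm T \<mu> \<partial>P)\<^sup>2"
proof -
  interpret P: real_distribution P by fact
  interpret Z: prob_space std_normal by (rule prob_space_std_normal)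
  interpret pair_sigma_finite P std_normal ..
  let ?h = "truncated_norm T" and ?e = "\<lambda>\<mu> x. exp (\<mu> * x - \<mu>\<^sup>2 / 2)"
  have h: "0 < ?h \<mu>" for \<mu> by (rule truncated_norm_pos)
  have "(lik_ratio P x)\<^sup>2 \<le> (\<integral>\<^sup>+\<mu>. ?h \<mu> \<partial>P) * (\<integral>\<^sup>+\<mu>. ennreal ((?e \<mu> x)\<^sup>2 / ?h \<mu>) \<partial>P)" for x
  proof -
    have "lik_ratio P x = (\<integral>\<^sup>+\<mu>. ennreal (sqrt (?h \<mu>)) * ennreal (?e \<mu> x / sqrt (?h \<mu>)) \<partial>P)"
      unfolding lik_ratio_def using h less_imp_le[OF h] by (simp add: ennreal_mult[symmetric] less_imp_neq[symmetric])
    also have "\<dots>\<^sup>2 \<le> (\<integral>\<^sup>+\<mu>. (ennreal (sqrt (?h \<mu>)))\<^sup>2 \<partial>P) * (\<integral>\<^sup>+\<mu>. (ennreal (?e \<mu> x / sqrt (?h \<mu>)))\<^sup>2 \<partial>P)"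
      by (rule Cauchy_Schwarz_nn_integral) measurable
    also have "\<dots> = (\<integral>\<^sup>+\<mu>. ?h \<mu> \<partial>P) * (\<integral>\<^sup>+\<mu>. ennreal ((?e \<mu> x)\<^sup>2 / ?h \<mu>) \<partial>P)"
      using less_imp_le[OF h] by (simp add: ennreal_power power_divide)
    finally show ?thesis .
  qed
  then have "(\<integral>\<^sup>+x. (lik_ratio P x)\<^sup>2 * indicator {-T..T} x \<partial>std_normal) \<le>
      (\<integral>\<^sup>+x. ((\<integral>\<^sup>+\<mu>. ?h \<mu> \<partial>P) * (\<integral>\<^sup>+\<mu>. ennreal ((?e \<mu> x)\<^sup>2 / ?h \<mu>) \<partial>P)) * indicator {-T..T} x \<partial>std_normal)"
    by (intro nn_integral_mono mult_right_mono) auto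
  also have "\<dots> = (\<integral>\<^sup>+\<mu>. ?h \<mu> \<partial>P) * (\<integral>\<^sup>+x. (\<integral>\<^sup>+\<mu>. ennreal ((?e \<mu> x)\<^sup>2 / ?h \<mu>) \<partial>P) * indicator {-T..T} x \<partial>std_normal)"
    by (subst nn_integral_cmult[symmetric]) (auto simp: mult.assoc)
  also have "(\<integral>\<^sup>+x. (\<integral>\<^sup>+\<mu>. ennreal ((?e \<mu> x)\<^sup>2 / ?h \<mu>) \<partial>P) * indicator {-T..T} x \<partial>std_normal) =
      (\<integral>\<^sup>+x. (\<integral>\<^sup>+\<mu>. ennreal ((?e \<mu> x)\<^sup>2 / ?h \<mu>) * indicator {-T..T} x \<partial>P) \<partial>std_normal)"
    by (intro nn_integral_cong nn_integral_multc[symmetric]) measurable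
  also have "\<dots> = (\<integral>\<^sup>+\<mu>. (\<integral>\<^sup>+x. ennreal ((?e \<mu> x)\<^sup>2 / ?h \<mu>) * indicator {-T..T} x \<partial>std_normal) \<partial>P)"
    by (rule Fubini') measurable
  also have "\<dots> \<le> (\<integral>\<^sup>+\<mu>. ?h \<mu> \<partial>P)"
  proof (rule nn_integral_mono)
    fix \<mu>
    have "(\<integral>\<^sup>+x. ennreal ((?e \<mu> x)\<^sup>2 / ?h \<mu>) * indicator {-T..T} x \<partial>std_normal) =
      (\<integral>\<^sup>+x. ennreal (1 / ?h \<mu>) * (ennreal ((?e \<mu> x)\<^sup>2) * indicator {-T..T} x) \<partial>std_normal)"
      using h[of \<mu>] by (simp add: ennreal_mult[symmetric] mult.assoc[symmetric])
    also have "\<dots> = ennreal (1 / ?h \<mu>) * (\<integral>\<^sup>+x. ennreal ((?e \<mu> x)\<^sup>2) * indicator {-T..T} x \<partial>std_normal)"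
      by (rule nn_integral_cmult) measurable
    also have "\<dots> \<le> ennreal (1 / ?h \<mu>) * ennreal ((?h \<mu>)\<^sup>2)"
      by (intro mult_left_mono truncated_norm_bound) simp
    also have "\<dots> = ennreal (?h \<mu>)"
      using h[of \<mu>] by (simp add: ennreal_mult[symmetric] power2_eq_square)
    finally show "(\<integral>\<^sup>+x. ennreal ((?e \<mu> x)\<^sup>2 / ?h \<mu>) * indicator {-T..T} x \<partial>std_normal) \<le> ennreal (?h \<mu>)" .
  qed
  finally show ?thesis by (simp add: power2_eq_square mult_left_mono)
qed

section \<open>Tails of the signal component and total variation\<close>

lemma emeasure_noisy_tail:
  assumes "real_distribution P"
  shows "emeasure (noisy P) {x. \<bar>x\<bar> > T} = (\<integral>\<^sup>+\<mu>. emeasure std_normal {x. \<bar>\<mu> + x\<bar> > T} \<partial>P)"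
proof -
  interpret P: real_distribution P by fact
  have m: "{x::real. \<bar>x\<bar> > T} \<in> sets borel" "{x. \<bar>\<mu> + x\<bar> > T} \<in> sets borel" for \<mu> by measurable
  have "emeasure (noisy P) {x. \<bar>x\<bar> > T} = (\<integral>\<^sup>+x. indicator {x. \<bar>x\<bar> > T} x \<partial>noisy P)"
    using m by (subst nn_integral_indicator) simp_all
  also have "\<dots> = (\<integral>\<^sup>+\<mu>. \<integral>\<^sup>+x. indicator {x. \<bar>x\<bar> > T} (\<mu> + x) \<partial>std_normal \<partial>P)"
    using m by (intro nn_integral_noisy[OF assms]) measurable
  also have "\<dots> = (\<integral>\<^sup>+\<mu>. \<integral>\<^sup>+x. indicator {x. \<bar>\<mu> + x\<bar> > T} x \<partial>std_normal \<partial>P)"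
    by (intro nn_integral_cong) (auto split: split_indicator)
  also have "\<dots> = (\<integral>\<^sup>+\<mu>. emeasure std_normal {x. \<bar>\<mu> + x\<bar> > T} \<partial>P)"
    using m(2) by (intro nn_integral_cong nn_integral_indicator) simp
  finally show ?thesis .
qed

text \<open>The reciprocal of the constant in \<open>std_normal_shifted_tail_ge\<close>.\<close>

definition gauss_tail_const :: real where
  "gauss_tail_const = sqrt (2 * pi) / exp (- 3 / 2)"

lemma gauss_tail_const_pos: "0 < gauss_tail_const"
  by (simp add: gauss_tail_const_def)

lemma nn_integral_gauss_le_noisy_tail:
  assumes P: "real_distribution P" and T: "T \<ge> 1"
  shows "(\<integral>\<^sup>+\<mu>. ennreal (exp (- (max 0 (T - \<bar>\<mu>\<bar>))\<^sup>2 / 2)) \<partial>P) \<le> ennreal (gauss_tail_const * T * measure (noisy P) {x. \<bar>x\<bar> > T})"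
proof -
  interpret P: real_distribution P by fact
  interpret N: real_distribution "noisy P" by (rule real_distribution_noisy[OF P])
  interpret Z: prob_space std_normal by (rule prob_space_std_normal)
  have [measurable]: "(\<lambda>\<mu>. emeasure std_normal {x. \<bar>\<mu> + x\<bar> > T}) \<in> borel_measurable borel"
  proof -
    have "(\<lambda>\<mu>. emeasure std_normal (Pair \<mu> -` {z \<in> space (borel \<Otimes>\<^sub>M std_normal). \<bar>fst z + snd z\<bar> > T})) \<in> borel_measurable borel"
      by (rule Z.measurable_emeasure_Pair) measurable
    then show ?thesis by (simp add: space_pair_measure)
  qed
  have "exp (- (max 0 (T - \<bar>\<mu>\<bar>))\<^sup>2 / 2) \<le> gauss_tail_const * T * measure std_normal {x. \<bar>\<mu> + x\<bar> > T}" for \<mu>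
  proof -
    have "gauss_tail_const * T * (exp (- 3 / 2) / sqrt (2 * pi) / T * exp (- (max 0 (T - \<bar>\<mu>\<bar>))\<^sup>2 / 2)) \<le>
      gauss_tail_const * T * measure std_normal {x. \<bar>\<mu> + x\<bar> > T}"
      using gauss_tail_const_pos T by (intro mult_left_mono std_normal_shifted_tail_ge) auto
    then show ?thesis using T by (simp add: gauss_tail_const_def)
  qed
  then have "(\<integral>\<^sup>+\<mu>. ennreal (exp (- (max 0 (T - \<bar>\<mu>\<bar>))\<^sup>2 / 2)) \<partial>P) \<le>
      (\<integral>\<^sup>+\<mu>. ennreal (gauss_tail_const * T) * emeasure std_normal {x. \<bar>\<mu> + x\<bar> > T} \<partial>P)"
    using gauss_tail_const_pos T
    by (intro nn_integral_mono) (auto simp: Z.emeasure_eq_measure ennreal_mult[symmetric] intro!: ennreal_leI)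
  also have "\<dots> = ennreal (gauss_tail_const * T) * emeasure (noisy P) {x. \<bar>x\<bar> > T}"
    by (simp add: nn_integral_cmult emeasure_noisy_tail[OF P])
  finally show ?thesis
    using gauss_tail_const_pos T by (simp add: N.emeasure_eq_measure ennreal_mult[symmetric])
qed

text \<open>Beyond T / 2 the truncated norm is at most \<open>exp (T\<^sup>2 / 4)\<close> times the
  Gaussian weight of the previous lemma, the \<open>max\<close> only enlarging the weight when
  |\<mu>| > T. So large means are paid for by the observable tail, and only small means
  remain.\<close>

lemma nn_integral_truncated_norm_le:
  assumes P: "real_distribution P" and T: "T \<ge> 1"
  shows "(\<integral>\<^sup>+\<mu>. truncated_norm T \<mu> \<partial>P) \<le>
    (\<integral>\<^sup>+\<mu>. ennreal (exp (\<mu>\<^sup>2 / 2)) * indicator {-T / 2..T / 2} \<mu> \<partial>P) +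
    ennreal (exp (T\<^sup>2 / 4) * (gauss_tail_const * T * measure (noisy P) {x. \<bar>x\<bar> > T}))"
proof -
  interpret P: real_distribution P by fact
  have "(\<integral>\<^sup>+\<mu>. truncated_norm T \<mu> \<partial>P) \<le>
      (\<integral>\<^sup>+\<mu>. ennreal (exp (\<mu>\<^sup>2 / 2)) * indicator {-T / 2..T / 2} \<mu> + ennreal (exp (T\<^sup>2 / 4)) * ennreal (exp (- (max 0 (T - \<bar>\<mu>\<bar>))\<^sup>2 / 2)) \<partial>P)"
    by (intro nn_integral_mono)
      (auto simp: truncated_norm_def ennreal_mult[symmetric] exp_add[symmetric] ennreal_plus[symmetric]
        max_def simp del: ennreal_plus split: split_indicator)
  also have "\<dots> = (\<integral>\<^sup>+\<mu>. ennreal (exp (\<mu>\<^sup>2 / 2)) * indicator {-T / 2..T / 2} \<mu> \<partial>P) +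
      ennreal (exp (T\<^sup>2 / 4)) * (\<integral>\<^sup>+\<mu>. ennreal (exp (- (max 0 (T - \<bar>\<mu>\<bar>))\<^sup>2 / 2)) \<partial>P)"
    by (simp add: nn_integral_add nn_integral_cmult)
  also have "\<dots> \<le> (\<integral>\<^sup>+\<mu>. ennreal (exp (\<mu>\<^sup>2 / 2)) * indicator {-T / 2..T / 2} \<mu> \<partial>P) +
      ennreal (exp (T\<^sup>2 / 4)) * ennreal (gauss_tail_const * T * measure (noisy P) {x. \<bar>x\<bar> > T})"
    by (intro add_left_mono mult_left_mono nn_integral_gauss_le_noisy_tail[OF P T]) simp
  finally show ?thesis
    using gauss_tail_const_pos T by (simp add: ennreal_mult)
qed

text \<open>The minorant is \<open>(1 - p) + p * g\<close>, with \<open>g\<close> the likelihood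
  ratio cut off outside [-T, T]. Its mean falls short of 1 by exactly \<open>p\<close> times the
  tail mass, and its second moment exceeds 1 by at most \<open>(p * H)\<^sup>2\<close>.\<close>

lemma tv_dist_sparse_mixture_le:
  fixes H p :: real
  assumes P: "real_distribution P" and p: "0 \<le> p" "p \<le> 1" and I: "finite I"
    and H: "(\<integral>\<^sup>+\<mu>. truncated_norm T \<mu> \<partial>P) \<le> ennreal H" "0 \<le> H"
  shows "tv_dist (PiM I (\<lambda>_. std_normal)) (PiM I (\<lambda>_. noisy (mixture p (return borel 0) P))) \<le>
    sqrt (exp (card I * (p * H)\<^sup>2) - 1 + 2 * (card I * p * measure (noisy P) {x. \<bar>x\<bar> > T}))"
proof -
  interpret P: real_distribution P by fact
  interpret Z: prob_space std_normal by (rule prob_space_std_normal)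
  interpret N: real_distribution "noisy P" by (rule real_distribution_noisy[OF P])
  note [measurable] = measurable_lik_ratio[OF P]
  let ?A = "{-T..T}" and ?q = "measure (noisy P) {x. \<bar>x\<bar> > T}"
  define g where "g x = enn2real (lik_ratio P x) * indicator ?A x" for x
  have lik_finite: "lik_ratio P x < \<infinity>" for x
    using lik_ratio_le[OF P, of x] by (auto intro: le_less_trans)
  have [measurable]: "g \<in> borel_measurable borel" unfolding g_def[abs_def] by measurable
  have g0: "0 \<le> g x" for x by (simp add: g_def)
  have ge: "ennreal (g x) = lik_ratio P x * indicator ?A x" for x
    using lik_finite[of x] by (auto simp: g_def split: split_indicator)
  have gC: "g x \<le> exp (T\<^sup>2 / 2)" for x
  proof (cases "x \<in> ?A")
    case True
    then have "x\<^sup>2 \<le> T\<^sup>2" by (intro power2_le_iff_abs_le[THEN iffD2]) auto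
    then have "ennreal (exp (x\<^sup>2 / 2)) \<le> ennreal (exp (T\<^sup>2 / 2))" by (intro ennreal_leI) simp
    with lik_ratio_le[OF P, of x] have "ennreal (g x) \<le> ennreal (exp (T\<^sup>2 / 2))"
      unfolding ge using True by (auto intro: order_trans)
    then show ?thesis by (subst (asm) ennreal_le_iff) auto
  qed (simp add: g_def)
  have ig: "integrable std_normal g"
    using g0 gC by (intro Z.integrable_const_bound[where B = "exp (T\<^sup>2 / 2)"]) auto
  have ig2: "integrable std_normal (\<lambda>x. (g x)\<^sup>2)"
    using g0 gC by (intro Z.integrable_const_bound[where B = "(exp (T\<^sup>2 / 2))\<^sup>2"]) (auto intro!: power_mono)
  have Eg: "(\<integral>x. g x \<partial>std_normal) = 1 - ?q"
  proof -
    have "ennreal (\<integral>x. g x \<partial>std_normal) = (\<integral>\<^sup>+x. lik_ratio P x * indicator ?A x \<partial>std_normal)"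
      using ig g0 by (simp add: nn_integral_eq_integral[symmetric] ge)
    also have "\<dots> = emeasure (noisy P) ?A"
      unfolding noisy_eq_density[OF P] by (rule emeasure_density[symmetric]) simp_all
    finally have "(\<integral>x. g x \<partial>std_normal) = measure (noisy P) ?A"
      using g0 by (simp add: N.emeasure_eq_measure)
    also have "?A = UNIV - {x. \<bar>x\<bar> > T}" by auto
    also have "measure (noisy P) \<dots> = 1 - ?q"
      using N.prob_compl[of "{x. \<bar>x\<bar> > T}"] by simp
    finally show ?thesis .
  qed
  have Eg2: "(\<integral>x. (g x)\<^sup>2 \<partial>std_normal) \<le> H\<^sup>2"
  proof -
    have "ennreal (\<integral>x. (g x)\<^sup>2 \<partial>std_normal) = (\<integral>\<^sup>+x. ennreal ((g x)\<^sup>2) \<partial>std_normal)"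
      using ig2 by (simp add: nn_integral_eq_integral)
    also have "\<dots> = (\<integral>\<^sup>+x. (lik_ratio P x)\<^sup>2 * indicator ?A x \<partial>std_normal)"
      using g0 by (intro nn_integral_cong) (simp add: ennreal_power[symmetric] ge power_mult_distrib split: split_indicator)
    also have "\<dots> \<le> (ennreal H)\<^sup>2"
      using lik_ratio_second_moment[OF P, of T] H(1) by (meson order_trans power_mono zero_le)
    finally show ?thesis using H(2) by (simp add: ennreal_power)
  qed
  define f where "f x = (1 - p) + p * g x" for x
  have [measurable]: "f \<in> borel_measurable borel" unfolding f_def[abs_def] by measurable
  have Ef: "(\<integral>x. f x \<partial>std_normal) = 1 - p * ?q"
    unfolding f_def using ig by (simp add: Eg Z.prob_space[simplified] algebra_simps)
  have "(\<integral>x. (f x)\<^sup>2 \<partial>std_normal) = (\<integral>x. (1 - p)\<^sup>2 + 2 * (1 - p) * p * g x + p\<^sup>2 * (g x)\<^sup>2 \<partial>std_normal)"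
    unfolding f_def by (simp add: power2_eq_square algebra_simps)
  also have "\<dots> = (1 - p)\<^sup>2 + 2 * (1 - p) * p * (1 - ?q) + p\<^sup>2 * (\<integral>x. (g x)\<^sup>2 \<partial>std_normal)"
    using ig ig2 by (simp add: Eg Z.prob_space[simplified])
  also have "\<dots> \<le> (1 - p)\<^sup>2 + 2 * (1 - p) * p * 1 + p\<^sup>2 * H\<^sup>2"
    using p Eg2 by (intro add_mono mult_left_mono) auto
  \<comment> \<open>The first two terms add up to \<open>1 - p\<^sup>2\<close>.\<close>
  also have "\<dots> \<le> 1 + (p * H)\<^sup>2"
    using p by (simp add: power2_eq_square algebra_simps)
  finally have Ef2: "(\<integral>x. (f x)\<^sup>2 \<partial>std_normal) \<le> 1 + (p * H)\<^sup>2" .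
  let ?l = "\<lambda>x. ennreal (1 - p) + ennreal p * lik_ratio P x"
  have eq: "noisy (mixture p (return borel 0) P) = density std_normal ?l"
    by (rule noisy_mixture_eq_density[OF P p])
  have "real_distribution (mixture p (return borel (0::real)) P)"
    using P p by (intro real_distribution_mixture real_distribution_return)
  then have N': "prob_space (density std_normal ?l)"
    using real_distribution_noisy unfolding eq[symmetric] by (auto simp: real_distribution_def)
  have "tv_dist (PiM I (\<lambda>_. std_normal)) (PiM I (\<lambda>_. density std_normal ?l)) \<le>
      sqrt ((\<integral>x. (f x)\<^sup>2 \<partial>std_normal) ^ card I - 2 * (\<integral>x. f x \<partial>std_normal) ^ card I + 1)"
  proof (rule tv_dist_PiM_density_le[OF I prob_space_std_normal N', where C = "(1 - p) + p * exp (T\<^sup>2 / 2)"])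
    show "0 \<le> f x" "f x \<le> (1 - p) + p * exp (T\<^sup>2 / 2)" for x
      using p g0 gC by (auto simp: f_def mult_left_mono)
    show "ennreal (f x) \<le> ?l x" for x
    proof -
      have "ennreal (f x) = ennreal (1 - p) + ennreal p * ennreal (g x)"
        using p g0 by (simp add: f_def ennreal_mult)
      also have "\<dots> \<le> ?l x"
        by (intro add_left_mono mult_left_mono) (auto simp: ge split: split_indicator)
      finally show ?thesis .
    qed
  qed simp_all
  also have "\<dots> \<le> sqrt (exp (card I * (p * H)\<^sup>2) - 1 + 2 * (card I * p * ?q))"
  proof -
    have "(\<integral>x. (f x)\<^sup>2 \<partial>std_normal) ^ card I \<le> (1 + (p * H)\<^sup>2) ^ card I"
      using Ef2 by (intro power_mono) auto
    also have "\<dots> \<le> exp ((p * H)\<^sup>2) ^ card I"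
      by (intro power_mono exp_ge_add_one_self) auto
    also have "\<dots> = exp (card I * (p * H)\<^sup>2)" by (simp add: exp_of_nat_mult)
    finally have 1: "(\<integral>x. (f x)\<^sup>2 \<partial>std_normal) ^ card I \<le> exp (card I * (p * H)\<^sup>2)" .
    \<comment> \<open>Bernoulli's inequality turns the \<open>card I\<close>-th power of the mean
      into a loss linear in the expected number of signals beyond T.\<close>
    have "p * ?q \<le> 1" using p by (intro mult_le_one) auto
    then have "1 + card I * (- (p * ?q)) \<le> (1 + - (p * ?q)) ^ card I"
      by (intro Bernoulli_inequality) simp
    with 1 show ?thesis by (simp add: Ef mult.assoc)
  qed
  finally show ?thesis unfolding eq .
qed

text \<open>Markov's inequality for the Gaussian weight: it is at least its value at |\<mu>| = t on
  the event. Taking t = 0 gives positivity of the tail; t = T and t = T / 2 are used for scale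
  families.\<close>

lemma noisy_tail_ge:
  assumes P: "real_distribution P" and T: "T \<ge> 1" and t: "t \<le> T"
  shows "exp (- (T - t)\<^sup>2 / 2) * measure P {\<mu>. t \<le> \<bar>\<mu>\<bar>} \<le> gauss_tail_const * T * measure (noisy P) {x. \<bar>x\<bar> > T}"
proof -
  interpret P: real_distribution P by fact
  have "ennreal (exp (- (T - t)\<^sup>2 / 2) * measure P {\<mu>. t \<le> \<bar>\<mu>\<bar>}) =
      (\<integral>\<^sup>+\<mu>. ennreal (exp (- (T - t)\<^sup>2 / 2)) * indicator {\<mu>. t \<le> \<bar>\<mu>\<bar>} \<mu> \<partial>P)"
    by (simp add: nn_integral_cmult P.emeasure_eq_measure ennreal_mult)
  also have "\<dots> \<le> (\<integral>\<^sup>+\<mu>. ennreal (exp (- (max 0 (T - \<bar>\<mu>\<bar>))\<^sup>2 / 2)) \<partial>P)"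
    using t by (intro nn_integral_mono) (auto split: split_indicator intro!: ennreal_leI power_mono)
  also have "\<dots> \<le> ennreal (gauss_tail_const * T * measure (noisy P) {x. \<bar>x\<bar> > T})"
    by (rule nn_integral_gauss_le_noisy_tail[OF P T])
  finally show ?thesis
    using gauss_tail_const_pos T by (subst (asm) ennreal_le_iff) auto
qed

lemma noisy_tail_pos:
  assumes P: "real_distribution P" and T: "T \<ge> 1"
  shows "0 < measure (noisy P) {x. \<bar>x\<bar> > T}"
proof -
  interpret P: real_distribution P by fact
  have "measure P {\<mu>. 0 \<le> \<bar>\<mu>\<bar>} = 1" using P.prob_space by simp
  then have "0 < gauss_tail_const * T * measure (noisy P) {x. \<bar>x\<bar> > T}"
    using noisy_tail_ge[OF P T, of 0] T by (simp add: less_le_trans[OF exp_gt_zero])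
  then show ?thesis using gauss_tail_const_pos T by (simp add: zero_less_mult_iff)
qed

section \<open>Levels that are not separable\<close>

text \<open>The cut-off at \<delta> = 1, for which \<open>exp (- T\<^sup>2 / 2)\<close> is 1 /
  n.\<close>

definition detection_threshold :: "nat \<Rightarrow> real" where
  "detection_threshold n = sqrt (2 * ln (real n))"

abbreviation noisy_tail :: "(nat \<Rightarrow> real measure) \<Rightarrow> nat \<Rightarrow> real" where
  "noisy_tail G n \<equiv> measure (noisy (G n)) {x. \<bar>x\<bar> > detection_threshold n}"

lemma detection_threshold_sq: "n \<ge> 1 \<Longrightarrow> (detection_threshold n)\<^sup>2 = 2 * ln (real n)"
  by (simp add: detection_threshold_def)

lemma eventually_detection_threshold_ge: "eventually (\<lambda>n. c \<le> detection_threshold n) sequentially"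
proof -
  have "filterlim detection_threshold at_top sequentially"
    unfolding detection_threshold_def[abs_def] by real_asymp
  then show ?thesis by (rule filterlim_at_top[THEN iffD1, THEN spec])
qed

lemma noisy_tail_eq_powr:
  assumes "real_distribution (G n)" "detection_threshold n \<ge> 1" "n \<ge> 2"
  shows "noisy_tail G n = real n powr tail_exponent G n 1"
  using noisy_tail_pos[OF assms(1,2)] assms(3)
  by (simp add: tail_exponent_def detection_threshold_def[symmetric] powr_log_cancel)

lemma eventually_noisy_tail:
  assumes G: "\<forall>n\<ge>1. real_distribution (G n)"
  shows "eventually (\<lambda>n. noisy_tail G n = real n powr tail_exponent G n 1) sequentially"
  using eventually_detection_threshold_ge[of 1] eventually_ge_at_top[of 2]
  by eventually_elim (use G in \<open>auto intro!: noisy_tail_eq_powr\<close>)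

lemma eventually_noisy_tail_le:
  assumes G: "\<forall>n\<ge>1. real_distribution (G n)"
    and \<tau>: "(\<lambda>n. tail_exponent G n 1) \<longlonglongrightarrow> \<tau>" and r: "r > \<tau>"
  shows "eventually (\<lambda>n. noisy_tail G n \<le> real n powr r) sequentially"
  using eventually_noisy_tail[OF G] order_tendstoD(2)[OF \<tau> r] eventually_ge_at_top[of 1]
  by eventually_elim (auto intro!: powr_mono)

lemma sparsity_weight: "n \<ge> 1 \<Longrightarrow> 0 \<le> \<beta> \<Longrightarrow> 0 \<le> real n powr (- \<beta>) \<and> real n powr (- \<beta>) \<le> 1"
  by (auto simp: powr_minus divide_simps ge_one_powr_ge_zero)

text \<open>\<open>J\<close> bounds the contribution of the means below T / 2. The total variation
  bound is small once sqrt n times weight times norm, and n times weight times tail, tend to zero.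
  The first is the condition on \<open>J\<close> plus a tail term, the second follows from \<beta> >
  1 + \<tau>.\<close>

lemma not_separable_level:
  assumes G: "\<forall>n\<ge>1. real_distribution (G n)"
    and \<tau>: "(\<lambda>n. tail_exponent G n 1) \<longlonglongrightarrow> \<tau>" and \<beta>: "0 \<le> \<beta>" "\<beta> > 1 + \<tau>"
    and J: "eventually (\<lambda>n. (\<integral>\<^sup>+\<mu>. ennreal (exp (\<mu>\<^sup>2 / 2)) *
        indicator {-detection_threshold n / 2..detection_threshold n / 2} \<mu> \<partial>G n) \<le> ennreal (J n)) sequentially"
    and J0: "\<And>n. 0 \<le> J n" and J_lim: "(\<lambda>n. real n powr (1 / 2 - \<beta>) * J n) \<longlonglongrightarrow> 0"
  shows "\<beta> \<notin> separable_levels G"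
proof
  let ?T = detection_threshold
  assume "\<beta> \<in> separable_levels G"
  then have lim1: "(\<lambda>n. tv_dist (H0 n) (H1 G \<beta> n)) \<longlonglongrightarrow> 1" by (simp add: separable_levels_def)
  \<comment> \<open>The midpoint of \<tau> and \<beta> - 1, leaving room on both sides.\<close>
  define r where "r = (\<beta> - 1 + \<tau>) / 2"
  have r: "\<tau> < r" "1 - \<beta> + r < 0" using \<beta> by (auto simp: r_def field_simps)
  define a where "a n = real n powr (1 / 2 - \<beta>) * J n + gauss_tail_const * (?T n * real n powr (1 - \<beta> + r))" for n
  define b where "b n = real n powr (1 - \<beta> + r)" for n
  have "(\<lambda>n. ?T n * real n powr (1 - \<beta> + r)) \<longlonglongrightarrow> 0"
    unfolding detection_threshold_def using r(2) by real_asymp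
  from tendsto_add[OF J_lim tendsto_mult_right_zero[OF this, of gauss_tail_const]]
  have a: "a \<longlonglongrightarrow> 0"
    by (simp add: a_def[abs_def])
  have b: "b \<longlonglongrightarrow> 0"
    unfolding b_def[abs_def] using r(2) by real_asymp
  have "(\<lambda>n. sqrt (exp ((a n)\<^sup>2) - 1 + 2 * b n)) \<longlonglongrightarrow> 0"
    using a b by (auto intro!: tendsto_eq_intros)
  then have "eventually (\<lambda>n. sqrt (exp ((a n)\<^sup>2) - 1 + 2 * b n) < 1 / 2) sequentially"
    by (rule order_tendstoD) simp
  moreover have "eventually (\<lambda>n. tv_dist (H0 n) (H1 G \<beta> n) \<le> sqrt (exp ((a n)\<^sup>2) - 1 + 2 * b n)) sequentially"
    using J eventually_noisy_tail_le[OF G \<tau> r(1)] eventually_detection_threshold_ge[of 1] eventually_ge_at_top[of 1]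
  proof eventually_elim
    case (elim n)
    note P = G[rule_format, OF elim(4)]
    let ?q = "noisy_tail G n" and ?p = "real n powr (- \<beta>)"
    define H where "H = J n + exp ((?T n)\<^sup>2 / 4) * (gauss_tail_const * ?T n * ?q)"
    have "(\<integral>\<^sup>+\<mu>. truncated_norm (?T n) \<mu> \<partial>G n) \<le> ennreal (J n) + ennreal (exp ((?T n)\<^sup>2 / 4) * (gauss_tail_const * ?T n * ?q))"
      by (rule order_trans[OF nn_integral_truncated_norm_le[OF P elim(3)]]) (intro add_right_mono elim(1))
    also have "\<dots> = ennreal H"
      using J0 elim(3) gauss_tail_const_pos by (simp add: H_def ennreal_plus)
    finally have H: "(\<integral>\<^sup>+\<mu>. truncated_norm (?T n) \<mu> \<partial>G n) \<le> ennreal H" .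
    have H0': "0 \<le> H" using J0 elim(3) gauss_tail_const_pos by (simp add: H_def)
    have p: "0 \<le> ?p" "?p \<le> 1" using sparsity_weight[OF elim(4) \<beta>(1)] by auto
    \<comment> \<open>This sqrt n from the large means, multiplied by the sqrt n of the second
      moment, yields the prefactor \<open>real n powr (1 - \<beta>)\<close> of the tail, so both
      conditions on the tail have the same exponent.\<close>
    have half: "exp ((?T n)\<^sup>2 / 4) = real n powr (1 / 2)"
      using elim(4) by (simp add: detection_threshold_sq powr_def)
    have n: "real n = real n powr 1" using elim(4) by simp
    have "real n powr (1 / 2) * (?p * H) = real n powr (1 / 2 - \<beta>) * J n + real n powr (1 - \<beta>) * (gauss_tail_const * ?T n * ?q)"
      unfolding H_def half distrib_left mult.assoc[symmetric] powr_add[symmetric] by simp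
    also have "\<dots> \<le> real n powr (1 / 2 - \<beta>) * J n + real n powr (1 - \<beta>) * (gauss_tail_const * ?T n * real n powr r)"
      using elim gauss_tail_const_pos by (intro add_left_mono mult_left_mono) auto
    also have "\<dots> = a n" by (simp add: a_def powr_add)
    finally have "real n powr (1 / 2) * (?p * H) \<le> a n" .
    then have "(real n powr (1 / 2) * (?p * H))\<^sup>2 \<le> (a n)\<^sup>2" using H0' by (intro power_mono) auto
    also have "(real n powr (1 / 2) * (?p * H))\<^sup>2 = real n * (?p * H)\<^sup>2"
      using elim(4) by (simp add: power_mult_distrib powr_half_sqrt)
    finally have 1: "real n * (?p * H)\<^sup>2 \<le> (a n)\<^sup>2" .
    have "real n * ?p * ?q = real n powr (1 - \<beta>) * ?q"
      by (subst n, subst powr_add[symmetric]) simp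
    also have "\<dots> \<le> b n" using elim by (simp add: b_def powr_add mult_left_mono)
    finally have 2: "real n * ?p * ?q \<le> b n" .
    have "tv_dist (H0 n) (H1 G \<beta> n) \<le> sqrt (exp (card {1..n} * (?p * H)\<^sup>2) - 1 + 2 * (card {1..n} * ?p * ?q))"
      unfolding H0_def H1_def sparse_prior_def
      by (rule tv_dist_sparse_mixture_le[OF P p _ H H0']) simp
    also have "\<dots> \<le> sqrt (exp ((a n)\<^sup>2) - 1 + 2 * b n)"
      using 1 2 by (intro real_sqrt_le_mono add_mono diff_mono) auto
    finally show ?case .
  qed
  ultimately have "eventually (\<lambda>n. tv_dist (H0 n) (H1 G \<beta> n) \<le> 1 / 2) sequentially"
    by eventually_elim simp
  from tendsto_upperbound[OF lim1 this] show False by simp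
qed

text \<open>For |\<mu>| \<le> T / 2 the norm is at most \<open>exp (T\<^sup>2 / 8)\<close>, which is
  the fourth root of n, whatever the prior. Against \<open>real n powr (1 / 2 - \<beta>)\<close>
  this vanishes because \<beta> > 3 / 4.\<close>

lemma separable_level_le_dense:
  assumes G: "\<forall>n\<ge>1. real_distribution (G n)"
    and \<tau>: "(\<lambda>n. tail_exponent G n 1) \<longlonglongrightarrow> \<tau>" and \<beta>: "\<beta> > 3 / 4" "\<beta> \<in> separable_levels G"
  shows "\<beta> \<le> 1 + \<tau>"
proof (rule ccontr)
  assume "\<not> \<beta> \<le> 1 + \<tau>"
  moreover have "eventually (\<lambda>n. (\<integral>\<^sup>+\<mu>. ennreal (exp (\<mu>\<^sup>2 / 2)) *
      indicator {-detection_threshold n / 2..detection_threshold n / 2} \<mu> \<partial>G n) \<le> ennreal (real n powr (1 / 4))) sequentially"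
    using eventually_ge_at_top[of 1]
  proof eventually_elim
    case (elim n)
    interpret P: real_distribution "G n" by (rule G[rule_format, OF elim])
    let ?T = "detection_threshold n"
    have T0: "0 \<le> ?T" using elim by (simp add: detection_threshold_def)
    have bound: "exp (\<mu>\<^sup>2 / 2) \<le> real n powr (1 / 4)" if "\<mu> \<in> {-?T / 2..?T / 2}" for \<mu>
    proof -
      have "\<mu>\<^sup>2 \<le> (?T / 2)\<^sup>2"
        using that by (intro power2_le_iff_abs_le[THEN iffD2]) (use T0 in auto)
      then show ?thesis using elim by (simp add: power_divide detection_threshold_sq powr_def)
    qed
    have "(\<integral>\<^sup>+\<mu>. ennreal (exp (\<mu>\<^sup>2 / 2)) * indicator {-?T / 2..?T / 2} \<mu> \<partial>G n) \<le> (\<integral>\<^sup>+\<mu>. ennreal (real n powr (1 / 4)) \<partial>G n)"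
      using bound by (intro nn_integral_mono) (auto split: split_indicator intro!: ennreal_leI)
    then show ?case using P.emeasure_space_1 by simp
  qed
  moreover have "(\<lambda>n. real n powr (1 / 2 - \<beta>) * real n powr (1 / 4)) \<longlonglongrightarrow> 0"
    using \<beta>(1) by real_asymp
  ultimately show False
    using not_separable_level[OF G \<tau>, of \<beta> "\<lambda>n. real n powr (1 / 4)"] \<beta> by simp
qed

section \<open>Power of the max test\<close>

lemma measurable_max_abs [measurable]:
  assumes "sets M = sets borel"
  shows "max_abs n \<in> borel_measurable (PiM {1..n} (\<lambda>_. M))"
proof -
  note [measurable_cong] = assms
  show ?thesis unfolding max_abs_def[abs_def] by (intro borel_measurable_Max) measurable
qed

lemma prob_max_abs_le:
  assumes M: "real_distribution M" and n: "n \<ge> 1"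
  shows "measure (PiM {1..n} (\<lambda>_. M)) {x \<in> space (PiM {1..n} (\<lambda>_. M)). max_abs n x \<le> t} =
    (1 - measure M {x. \<bar>x\<bar> > t}) ^ n"
proof -
  interpret M: real_distribution M by fact
  interpret product_sigma_finite "\<lambda>_. M" by standard
  have "{x \<in> space (PiM {1..n} (\<lambda>_. M)). max_abs n x \<le> t} = Pi\<^sub>E {1..n} (\<lambda>_. {x. \<bar>x\<bar> \<le> t})"
    using n by (auto simp: max_abs_def space_PiM PiE_iff extensional_def)
  then have "emeasure (PiM {1..n} (\<lambda>_. M)) {x \<in> space (PiM {1..n} (\<lambda>_. M)). max_abs n x \<le> t} =
      (\<Prod>i\<in>{1..n}. emeasure M {x. \<bar>x\<bar> \<le> t})"
    by (simp add: emeasure_PiM)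
  also have "\<dots> = ennreal (measure M {x. \<bar>x\<bar> \<le> t} ^ n)"
    by (simp add: M.emeasure_eq_measure ennreal_power)
  also have "{x. \<bar>x\<bar> \<le> t} = space M - {x. \<bar>x\<bar> > t}" by auto
  also have "measure M \<dots> = 1 - measure M {x. \<bar>x\<bar> > t}"
    by (rule M.prob_compl) simp
  finally show ?thesis
    by (rule measure_eq_emeasure_eq_ennreal[rotated]) simp
qed

text \<open>As the distribution function tends to 0 at minus infinity and p > 0, the set is bounded
  below, so its \<open>Inf\<close> is a genuine infimum.\<close>

lemma quantile_le:
  assumes P: "real_distribution P" and p: "0 < p" "p \<le> cdf P t"
  shows "quantile P p \<le> t"
proof -
  interpret P: real_distribution P by fact
  have "eventually (\<lambda>x. cdf P x < p) at_bot"
    using P.cdf_lim_at_bot p(1) by (rule order_tendstoD)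
  then obtain b where b: "\<And>x. x \<le> b \<Longrightarrow> cdf P x < p"
    by (auto simp: eventually_at_bot_linorder)
  then have "bdd_below {x. p \<le> cdf P x}"
    by (intro bdd_belowI[of _ b]) (metis linorder_not_le mem_Collect_eq nle_le)
  then show ?thesis unfolding quantile_def using p(2) by (intro cInf_lower) auto
qed

lemma real_distribution_std_normal: "real_distribution std_normal"
  using prob_space_std_normal by (simp add: real_distribution_def real_distribution_axioms_def)

text \<open>By Mills' bound n coordinates exceed T with total probability at most 1 / T. The factor
  1 / T is essential: it pushes this below any fixed \<alpha>.\<close>

lemma eventually_max_test_threshold_le:
  assumes \<alpha>: "0 < \<alpha>" "\<alpha> < 1"
  shows "eventually (\<lambda>n. max_test_threshold n \<alpha> \<le> detection_threshold n) sequentially"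
  using eventually_detection_threshold_ge[of "max 1 (1 / \<alpha>)"] eventually_ge_at_top[of 1]
proof eventually_elim
  case (elim n)
  let ?T = "detection_threshold n"
  have T: "1 \<le> ?T" "1 / \<alpha> \<le> ?T" using elim by auto
  let ?q = "measure std_normal {x. \<bar>x\<bar> > ?T}"
  interpret Z: prob_space std_normal by (rule prob_space_std_normal)
  interpret P: prob_space "H0 n"
    unfolding H0_def by (rule prob_space_PiM) (rule prob_space_std_normal)
  have m [measurable]: "max_abs n \<in> borel_measurable (H0 n)" unfolding H0_def by measurable
  interpret D: real_distribution "distr (H0 n) borel (max_abs n)" by (rule P.real_distribution_distr) measurable
  have "real n * ?q \<le> real n * (exp (- ?T\<^sup>2 / 2) / ?T)"
    using T by (intro mult_left_mono std_normal_tail_le) auto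
  also have "\<dots> = 1 / ?T" using elim(2) by (simp add: detection_threshold_sq exp_minus)
  also have "\<dots> \<le> \<alpha>" using T \<alpha> by (simp add: field_simps)
  finally have "1 - \<alpha> \<le> 1 + real n * (- ?q)" by simp
  also have "\<dots> \<le> (1 + - ?q) ^ n" by (rule Bernoulli_inequality) simp
  also have "\<dots> = cdf (distr (H0 n) borel (max_abs n)) ?T"
    using prob_max_abs_le[OF real_distribution_std_normal elim(2), of ?T]
    unfolding H0_def[symmetric] by (simp add: cdf_def measure_distr vimage_def Int_def conj_commute)
  finally show ?case
    unfolding max_test_threshold_def using \<alpha> by (intro quantile_le) (auto intro: D.real_distribution_axioms)
qed

lemma real_distribution_coordinate:
  assumes "real_distribution (G n)" "n \<ge> 1" "0 \<le> \<beta>"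
  shows "real_distribution (noisy (sparse_prior G \<beta> n))"
  unfolding sparse_prior_def using assms sparsity_weight[OF assms(2,3)]
  by (intro real_distribution_noisy real_distribution_mixture real_distribution_return) auto

text \<open>Each coordinate exceeds T with probability at least n to the power r - \<beta>, for some
  r slightly below \<tau>. By independence all n stay below T with probability at most
  \<open>exp (- (real n powr (1 - \<beta> + r)))\<close>.\<close>

lemma max_test_power_tendsto_1:
  assumes G: "\<forall>n\<ge>1. real_distribution (G n)"
    and \<tau>: "(\<lambda>n. tail_exponent G n 1) \<longlonglongrightarrow> \<tau>" and \<beta>: "0 \<le> \<beta>" "\<beta> < 1 + \<tau>" and \<alpha>: "0 < \<alpha>" "\<alpha> < 1"
  shows "(\<lambda>n. max_test_power G \<beta> n \<alpha>) \<longlonglongrightarrow> 1"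
proof -
  define r where "r = (\<beta> - 1 + \<tau>) / 2"
  have r: "r < \<tau>" "0 < 1 - \<beta> + r" using \<beta> by (auto simp: r_def field_simps)
  have lower: "eventually (\<lambda>n. 1 - exp (- (real n powr (1 - \<beta> + r))) \<le> max_test_power G \<beta> n \<alpha>) sequentially"
    using eventually_max_test_threshold_le[OF \<alpha>] eventually_noisy_tail[OF G]
      order_tendstoD(1)[OF \<tau> r(1)] eventually_ge_at_top[of 1]
  proof eventually_elim
    case (elim n)
    let ?T = "detection_threshold n" and ?p = "real n powr (- \<beta>)"
    let ?S = "{x::real. \<bar>x\<bar> > ?T}"
    have P: "real_distribution (G n)" using G elim(4) by simp
    have p: "0 \<le> ?p" "?p \<le> 1" using sparsity_weight[OF elim(4) \<beta>(1)] by auto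
    let ?M = "noisy (sparse_prior G \<beta> n)"
    have M: "real_distribution ?M"
      using G elim(4) \<beta>(1) by (intro real_distribution_coordinate) auto
    interpret M: real_distribution ?M by (rule M)
    interpret N: real_distribution "noisy (G n)" by (rule real_distribution_noisy[OF P])
    interpret H: prob_space "H1 G \<beta> n" unfolding H1_def by (rule prob_space_PiM) (rule M.prob_space_axioms)
    have m [measurable]: "max_abs n \<in> borel_measurable (H1 G \<beta> n)" unfolding H1_def by measurable
    have S: "?S \<in> sets borel" by measurable
    have "ennreal ?p * emeasure (noisy (G n)) ?S \<le> emeasure ?M ?S"
      unfolding sparse_prior_def noisy_mixture[OF P p] using S by (subst emeasure_mixture) auto
    then have "?p * noisy_tail G n \<le> measure ?M ?S"
      by (simp add: M.emeasure_eq_measure N.emeasure_eq_measure ennreal_mult[symmetric])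
    moreover have "real n powr r \<le> noisy_tail G n"
      using elim by (auto intro!: powr_mono)
    ultimately have "?p * real n powr r \<le> measure ?M ?S"
      using p by (meson mult_left_mono order_trans)
    then have "real n powr 1 * (?p * real n powr r) \<le> real n * measure ?M ?S"
      using elim(4) by (auto intro: mult_left_mono)
    moreover have "real n powr 1 * (?p * real n powr r) = real n powr (1 - \<beta> + r)"
      by (simp only: powr_add[symmetric]) (simp add: algebra_simps)
    ultimately have np: "real n powr (1 - \<beta> + r) \<le> real n * measure ?M ?S" by simp
    have "measure (H1 G \<beta> n) {x \<in> space (H1 G \<beta> n). max_abs n x \<le> ?T} = (1 - measure ?M ?S) ^ n"
      unfolding H1_def by (rule prob_max_abs_le[OF M elim(4)])
    also have "\<dots> \<le> exp (- measure ?M ?S) ^ n"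
      using exp_ge_add_one_self[of "- measure ?M ?S"] by (intro power_mono) auto
    also have "\<dots> \<le> exp (- (real n powr (1 - \<beta> + r)))"
      using np by (simp add: exp_of_nat_mult[symmetric])
    finally have "1 - exp (- (real n powr (1 - \<beta> + r))) \<le> 1 - measure (H1 G \<beta> n) {x \<in> space (H1 G \<beta> n). max_abs n x \<le> ?T}"
      by simp
    also have "\<dots> = measure (H1 G \<beta> n) (space (H1 G \<beta> n) - {x \<in> space (H1 G \<beta> n). max_abs n x \<le> ?T})"
      by (rule H.prob_compl[symmetric]) measurable
    also have "\<dots> \<le> max_test_power G \<beta> n \<alpha>"
      unfolding max_test_power_def using elim(1) by (intro H.finite_measure_mono) auto
    finally show ?case .
  qed
  have upper: "eventually (\<lambda>n. max_test_power G \<beta> n \<alpha> \<le> 1) sequentially"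
    using eventually_ge_at_top[of 1]
  proof eventually_elim
    case (elim n)
    have "prob_space (noisy (sparse_prior G \<beta> n))"
      using real_distribution_coordinate[of G n \<beta>] G elim \<beta>(1) by (auto simp: real_distribution_def)
    then interpret H: prob_space "H1 G \<beta> n" unfolding H1_def by (intro prob_space_PiM)
    show ?case unfolding max_test_power_def by simp
  qed
  show ?thesis
  proof (rule tendsto_sandwich[OF lower upper])
    show "(\<lambda>n. 1 - exp (- (real n powr (1 - \<beta> + r)))) \<longlonglongrightarrow> 1"
      using r(2) by real_asymp
  qed simp
qed

section \<open>Scale families with regularly varying tails\<close>

text \<open>Since \<open>q\<close> is real, the two tails cannot both vanish. A single vanishing
  tail contributes minus infinity to the maximum and 0 to the exponential.\<close>

lemma exp_neg_log_tail:
  assumes F: "real_distribution F" and q: "ereal q = neg_log_tail F \<theta>"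
  shows "exp (- q) = max (1 - cdf F \<theta>) (cdf F (- \<theta>))"
proof -
  interpret F: real_distribution F by fact
  have a: "0 \<le> 1 - cdf F \<theta>" and b: "0 \<le> cdf F (- \<theta>)"
    using F.cdf_bounded_prob[of \<theta>] F.cdf_nonneg[of "- \<theta>"] by auto
  have *: "ereal (- q) = max (ext_ln (1 - cdf F \<theta>)) (ext_ln (cdf F (- \<theta>)))"
    using q unfolding neg_log_tail_def by (metis ereal_uminus_uminus uminus_ereal.simps(1))
  consider "1 - cdf F \<theta> = 0" "cdf F (- \<theta>) = 0" | "1 - cdf F \<theta> = 0" "cdf F (- \<theta>) > 0"
    | "1 - cdf F \<theta> > 0" "cdf F (- \<theta>) = 0" | "1 - cdf F \<theta> > 0" "cdf F (- \<theta>) > 0"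
    using a b by linarith
  then show ?thesis
  proof cases
    case 4
    then have "- q = max (ln (1 - cdf F \<theta>)) (ln (cdf F (- \<theta>)))"
      using * by (simp add: ext_ln_def max_def split: if_splits)
    then show ?thesis using 4 by (simp add: max_def)
  qed (use * in \<open>simp_all add: ext_ln_def max_def\<close>)
qed

text \<open>Beyond the innermost cell, \<mu> lies in a layer on which the exponential is at most its
  value at the outer edge. Enlarging the indicator of the layer to that of everything beyond its
  inner edge leaves only tail probabilities to estimate.\<close>

lemma grid_bound:
  fixes \<mu> R :: real and K :: nat
  assumes K: "K \<ge> 1" and R: "R > 0" and \<mu>: "\<bar>\<mu>\<bar> \<le> R"
  shows "exp (\<mu>\<^sup>2 / 2) \<le> exp ((R / K)\<^sup>2 / 2) +
    (\<Sum>i=1..<K. exp ((R * (i + 1) / K)\<^sup>2 / 2) * indicator {\<mu>. R * i / K < \<bar>\<mu>\<bar>} \<mu>)"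
proof (cases "\<bar>\<mu>\<bar> \<le> R / K")
  case True
  then have "\<mu>\<^sup>2 \<le> (R / K)\<^sup>2"
    using R by (intro power2_le_iff_abs_le[THEN iffD2]) auto
  moreover have "0 \<le> (\<Sum>i=1..<K. exp ((R * (i + 1) / K)\<^sup>2 / 2) * indicator {\<mu>. R * i / K < \<bar>\<mu>\<bar>} \<mu>)"
    by (intro sum_nonneg) auto
  ultimately show ?thesis by (smt (verit) divide_right_mono exp_le_cancel_iff)
next
  case False
  \<comment> \<open>The ceiling minus one makes the inner edge strict and the outer edge closed. The
    ceiling is at least 2 here, so the natural subtraction does not truncate.\<close>
  define j where "j = nat \<lceil>\<bar>\<mu>\<bar> * K / R\<rceil> - 1"
  have z: "1 < \<bar>\<mu>\<bar> * K / R" "\<bar>\<mu>\<bar> * K / R \<le> K"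
    using False K R \<mu> by (auto simp: field_simps)
  have "2 \<le> \<lceil>\<bar>\<mu>\<bar> * K / R\<rceil>" using z(1) by (simp add: le_ceiling_iff)
  then have int_j: "int j = \<lceil>\<bar>\<mu>\<bar> * K / R\<rceil> - 1" and "1 \<le> j"
    unfolding j_def by linarith+
  then have j: "real j = \<lceil>\<bar>\<mu>\<bar> * K / R\<rceil> - 1" "1 \<le> j" by linarith+
  have "\<lceil>\<bar>\<mu>\<bar> * K / R\<rceil> \<le> int K" using z(2) by (simp add: ceiling_le_iff)
  then have jK: "j \<in> {1..<K}" using j(2) K by (auto simp: j_def)
  have "real j < \<bar>\<mu>\<bar> * K / R" "\<bar>\<mu>\<bar> * K / R \<le> real j + 1"
    unfolding j(1) by linarith+
  then have lo: "R * j / K < \<bar>\<mu>\<bar>" and hi: "\<bar>\<mu>\<bar> \<le> R * (j + 1) / K"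
    using K R by (auto simp: field_simps)
  have "\<mu>\<^sup>2 \<le> (R * (j + 1) / K)\<^sup>2"
    using R hi by (intro power2_le_iff_abs_le[THEN iffD2]) auto
  then have "exp (\<mu>\<^sup>2 / 2) \<le> exp ((R * (j + 1) / K)\<^sup>2 / 2) * indicator {\<mu>. R * j / K < \<bar>\<mu>\<bar>} \<mu>"
    using lo by simp
  also have "\<dots> \<le> (\<Sum>i=1..<K. exp ((R * (i + 1) / K)\<^sup>2 / 2) * indicator {\<mu>. R * i / K < \<bar>\<mu>\<bar>} \<mu>)"
    using jK by (intro member_le_sum) auto
  finally show ?thesis by (smt (verit) exp_gt_zero)
qed

text \<open>
  The only place where \<open>\<gamma> \<le> 2\<close> is needed: if the exponent is positive at some \<open>s\<close>, then it is
  largest at the end point \<open>s = 1\<close>.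
\<close>

lemma scaled_exponent_le:
  fixes s x y \<gamma> :: real
  assumes s: "0 < s" "s \<le> 1" and \<gamma>: "0 \<le> \<gamma>" "\<gamma> \<le> 2" and x: "0 \<le> x"
  shows "s\<^sup>2 * x - s powr \<gamma> * y \<le> max 0 (x - y)"
proof -
  have "s\<^sup>2 = s powr 2" using s by simp
  also have "\<dots> \<le> s powr \<gamma>" using s \<gamma> by (intro powr_mono') auto
  finally have "s\<^sup>2 * x - s powr \<gamma> * y \<le> s powr \<gamma> * (x - y)"
    using x by (simp add: right_diff_distrib mult_right_mono)
  also have "\<dots> \<le> s powr \<gamma> * max 0 (x - y)"
    by (intro mult_left_mono) auto
  also have "\<dots> \<le> 1 * max 0 (x - y)"
    using s \<gamma> by (intro mult_right_mono) (auto intro: powr_le1)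
  finally show ?thesis by simp
qed

text \<open>At a fraction s of T / 2 the prior has tail about
  \<open>exp (- (s powr \<gamma>) * Q (y n))\<close>, against a norm of n to the power s^2 / 4. By
  \<open>scaled_exponent_le\<close> the product is controlled by its value at s = 0 or s = 1. The
  latter is bounded through \<tau>, because signals of size T / 2 also feed the tail beyond
  T.\<close>

lemma separable_level_le_scale:
  assumes G: "\<forall>n\<ge>1. real_distribution (G n)"
    and \<tau>: "(\<lambda>n. tail_exponent G n 1) \<longlonglongrightarrow> \<tau>" and \<beta>: "\<beta> > 1 / 2" "\<beta> \<in> separable_levels G"
    and scale: "scale_family G F \<sigma>" and Q: "\<forall>\<theta>>0. ereal (Q \<theta>) = neg_log_tail F \<theta>"
    and rv: "regularly_varying Q" "regular_variation_index Q \<gamma>" and \<gamma>: "\<gamma> \<le> 2"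
  shows "\<beta> \<le> 1 + \<tau>"
proof (rule ccontr)
  assume "\<not> \<beta> \<le> 1 + \<tau>"
  then have \<beta>_gt: "\<beta> > 1 + \<tau>" by simp
  have \<beta>_le: "\<beta> \<le> 1" using \<beta>(2) by (simp add: separable_levels_def)
  let ?T = detection_threshold
  define y where "y n = ?T n / 2 / \<sigma> n" for n
  interpret F: real_distribution F using scale by (simp add: scale_family_def)
  note F = F.real_distribution_axioms
  have \<sigma>: "\<sigma> n > 0" and cdfG: "cdf (G n) \<mu> = cdf F (\<mu> / \<sigma> n)" if "n \<ge> 1" for n \<mu>
    using scale that by (auto simp: scale_family_def)
  have Qpos: "Q \<theta> > 0" if "\<theta> > 0" for \<theta> using rv(1) that by (simp add: regularly_varying_def)
  have expQ: "exp (- Q \<theta>) = max (1 - cdf F \<theta>) (cdf F (- \<theta>))" if "\<theta> > 0" for \<theta>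
    using exp_neg_log_tail[OF F] Q that by blast
  have Qmono: "Q a \<le> Q b" if "0 < a" "a \<le> b" for a b
  proof -
    have "exp (- Q b) \<le> exp (- Q a)"
      using that F.cdf_nondecreasing[of a b] F.cdf_nondecreasing[of "- b" "- a"]
      by (auto simp: expQ intro!: max.mono)
    then show ?thesis by simp
  qed
  have Qlim: "((\<lambda>x. Q (t * x) / Q x) \<longlongrightarrow> t powr \<gamma>) at_top" if "t > 0" for t
    using rv(2) that by (simp add: regular_variation_index_def)
  \<comment> \<open>\<open>Q\<close> is nondecreasing, so its ratios at doubled arguments are at
    least 1.\<close>
  have \<gamma>0: "0 \<le> \<gamma>"
  proof -
    have "eventually (\<lambda>x. 1 \<le> Q (2 * x) / Q x) at_top"
      using eventually_gt_at_top[of 0] by eventually_elim (use Qpos Qmono in auto)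
    then have "1 \<le> 2 powr \<gamma>" by (intro tendsto_lowerbound[OF Qlim]) auto
    then have "2 powr 0 \<le> 2 powr \<gamma>" by simp
    then show ?thesis by (subst (asm) powr_le_cancel_iff) auto
  qed
  have tail_ge: "exp (- Q (t / \<sigma> n)) \<le> measure (G n) {\<mu>. t \<le> \<bar>\<mu>\<bar>}" if n: "n \<ge> 1" and t: "t > 0" for n t
  proof -
    interpret Gn: real_distribution "G n" using G n by simp
    have "1 - cdf (G n) t = measure (G n) (space (G n) - {..t})"
      by (subst Gn.prob_compl) (simp_all add: cdf_def)
    also have "\<dots> \<le> measure (G n) {\<mu>. t \<le> \<bar>\<mu>\<bar>}"
      by (intro Gn.finite_measure_mono) auto
    finally have "1 - cdf (G n) t \<le> measure (G n) {\<mu>. t \<le> \<bar>\<mu>\<bar>}" .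
    moreover have "cdf (G n) (- t) \<le> measure (G n) {\<mu>. t \<le> \<bar>\<mu>\<bar>}"
      unfolding cdf_def by (intro Gn.finite_measure_mono) auto
    ultimately show ?thesis using n t \<sigma>[OF n] by (simp add: expQ cdfG)
  qed
  \<comment> \<open>The factor 2 counts the two tails, each at most their maximum.\<close>
  have tail_le: "measure (G n) {\<mu>. t < \<bar>\<mu>\<bar>} \<le> 2 * exp (- Q (t / \<sigma> n))" if n: "n \<ge> 1" and t: "t > 0" for n t
  proof -
    interpret Gn: real_distribution "G n" using G n by simp
    have "measure (G n) {\<mu>. t < \<bar>\<mu>\<bar>} \<le> measure (G n) ((space (G n) - {..t}) \<union> {..- t})"
      by (intro Gn.finite_measure_mono) auto
    also have "\<dots> \<le> measure (G n) (space (G n) - {..t}) + measure (G n) {..- t}"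
      by (intro measure_Un_le) auto
    also have "\<dots> = (1 - cdf (G n) t) + cdf (G n) (- t)"
      by (subst Gn.prob_compl) (simp_all add: cdf_def)
    also have "\<dots> \<le> 2 * exp (- Q (t / \<sigma> n))"
      using n t \<sigma>[OF n] by (simp add: expQ cdfG max_def)
    finally show ?thesis .
  qed
  \<comment> \<open>Regular variation speaks only about large arguments. Here \<tau> < \<beta> - 1
    \<le> 0, so the mass of the prior beyond T vanishes and \<open>Q (?T n / \<sigma> n)\<close>
    exceeds every fixed value of \<open>Q\<close>; monotonicity then drives the argument, which is
    \<open>2 * y n\<close>, to infinity.\<close>
  have y_top: "filterlim y at_top sequentially"
  proof (rule filterlim_at_top_gt[where c = 0, THEN iffD2], intro allI impI)
    fix M :: real assume M: "M > 0"
    have r: "\<tau> < (\<beta> - 1 + \<tau>) / 2" "(\<beta> - 1 + \<tau>) / 2 < 0" using \<beta>_gt \<beta>_le by auto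
    have "(\<lambda>n. ?T n * real n powr ((\<beta> - 1 + \<tau>) / 2)) \<longlonglongrightarrow> 0"
      unfolding detection_threshold_def using r(2) by real_asymp
    from tendsto_mult_right_zero[OF this, of gauss_tail_const]
    have "eventually (\<lambda>n. gauss_tail_const * (?T n * real n powr ((\<beta> - 1 + \<tau>) / 2)) < exp (- Q (2 * M))) sequentially"
      by (rule order_tendstoD) simp
    then show "eventually (\<lambda>n. M \<le> y n) sequentially"
      using eventually_noisy_tail_le[OF G \<tau> r(1)] eventually_detection_threshold_ge[of 1] eventually_ge_at_top[of 1]
    proof eventually_elim
      case (elim n)
      have "exp (- Q (?T n / \<sigma> n)) \<le> exp (- (?T n - ?T n)\<^sup>2 / 2) * measure (G n) {\<mu>. ?T n \<le> \<bar>\<mu>\<bar>}"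
        using tail_ge[OF elim(4), of "?T n"] elim(3) by simp
      also have "\<dots> \<le> gauss_tail_const * ?T n * noisy_tail G n"
        using G elim(3,4) by (intro noisy_tail_ge) auto
      also have "\<dots> \<le> gauss_tail_const * ?T n * real n powr ((\<beta> - 1 + \<tau>) / 2)"
        using elim gauss_tail_const_pos by (intro mult_left_mono) auto
      also have "\<dots> < exp (- Q (2 * M))" using elim(1) by (simp add: mult.assoc)
      finally have "Q (2 * M) < Q (?T n / \<sigma> n)" by simp
      moreover have "Q (?T n / \<sigma> n) \<le> Q (2 * M)" if "y n < M"
        using that elim(3) \<sigma>[OF elim(4)] by (intro Qmono) (auto simp: y_def field_simps)
      ultimately show ?case by (meson linorder_not_le)
    qed
  qed
  \<comment> \<open>The losses to absorb, in multiples of \<rho>: 2 in the tail estimate, 1/2 from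
    regular variation, 1/2 from the grid, and 1 for the margin in \<open>e\<close>. They total
    4.\<close>
  define \<rho> where "\<rho> = min (\<beta> - 1 / 2) (\<beta> - 1 - \<tau>) / 5"
  have \<rho>: "0 < \<rho>" "5 * \<rho> \<le> \<beta> - 1 / 2" "5 * \<rho> \<le> \<beta> - 1 - \<tau>"
    using \<beta>(1) \<beta>_gt by (auto simp: \<rho>_def)
  \<comment> \<open>\<eta> is the relative error allowed in regular variation; 1/2 keeps
    \<open>1 - \<eta>\<close> away from 0 when \<open>Q (y n)\<close> is bounded from above
    later.\<close>
  define \<eta> where "\<eta> = min (1 / 2) \<rho>"
  have \<eta>: "0 < \<eta>" "\<eta> \<le> 1 / 2" "\<eta> \<le> \<rho>" using \<rho> by (auto simp: \<eta>_def)
  obtain K0 :: nat where K0: "1 / \<rho> < K0" using reals_Archimedean2 by blast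
  define K where "K = max 1 K0"
  have K: "K \<ge> 1" "1 / K \<le> \<rho>"
  proof -
    have "1 / \<rho> \<le> real K" using K0 by (simp add: K_def)
    then show "1 / K \<le> \<rho>" using \<rho>(1) by (simp add: K_def field_simps)
  qed (simp add: K_def)
  \<comment> \<open>With this exponent, \<open>real n powr (1 / 2 - \<beta>) * real n powr e\<close>
    decays like \<open>real n powr (- \<rho>)\<close>.\<close>
  define e where "e = \<beta> - 1 / 2 - \<rho>"
  \<comment> \<open>With \<open>K\<close> fixed there are finitely many grid points, so the
    pointwise limits of regular variation suffice.\<close>
  have grid: "eventually (\<lambda>n. \<forall>i\<in>{1..<K}. (1 - \<eta>) * (i / K) powr \<gamma> * Q (y n) \<le> Q (i / K * y n)) sequentially"
  proof (intro eventually_ball_finite ballI)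
    fix i assume i: "i \<in> {1..<K}"
    then have s: "0 < real i / real K" by simp
    have "0 < (i / K) powr \<gamma>" using i by simp
    then have "(1 - \<eta>) * (i / K) powr \<gamma> < (i / K) powr \<gamma>"
      using mult_strict_right_mono[of "1 - \<eta>" 1 "(i / K) powr \<gamma>"] \<eta> by simp
    with Qlim[OF s] have "eventually (\<lambda>x. (1 - \<eta>) * (i / K) powr \<gamma> < Q (i / K * x) / Q x) at_top"
      by (rule order_tendstoD)
    then have "eventually (\<lambda>x. (1 - \<eta>) * (i / K) powr \<gamma> * Q x \<le> Q (i / K * x)) at_top"
      using eventually_gt_at_top[of 0]
    proof eventually_elim
      case (elim x)
      then show ?case using pos_less_divide_eq[OF Qpos[of x]] less_imp_le by blast
    qed
    then show "eventually (\<lambda>n. (1 - \<eta>) * (i / K) powr \<gamma> * Q (y n) \<le> Q (i / K * y n)) sequentially"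
      using y_top by (rule eventually_compose_filterlim)
  qed simp
  have log_small: "eventually (\<lambda>n. ln (gauss_tail_const * ?T n) \<le> \<rho> * ln (real n)) sequentially"
    unfolding detection_threshold_def using \<rho>(1) gauss_tail_const_pos by real_asymp
  have \<tau>_less: "\<tau> < \<tau> + \<rho>" using \<rho>(1) by simp
  define J where "J n = 2 * real K * real n powr e" for n
  have "eventually (\<lambda>n. (\<integral>\<^sup>+\<mu>. ennreal (exp (\<mu>\<^sup>2 / 2)) * indicator {-?T n / 2..?T n / 2} \<mu> \<partial>G n) \<le> ennreal (J n)) sequentially"
    using grid log_small eventually_noisy_tail[OF G] order_tendstoD(2)[OF \<tau> \<tau>_less]
      eventually_detection_threshold_ge[of 1] eventually_ge_at_top[of 2]
  proof eventually_elim
    case (elim n)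
    interpret Gn: real_distribution "G n" using G elim(6) by simp
    let ?L = "ln (real n)" and ?R = "?T n / 2" and ?q = "Q (y n)"
    have n1: "n \<ge> 1" using elim(6) by simp
    have L: "0 < ?L" using elim(6) by simp
    have R: "0 < ?R" using elim(5) by simp
    have Tsq: "(?T n)\<^sup>2 = 2 * ?L" by (rule detection_threshold_sq[OF n1])
    \<comment> \<open>The tail bound at t = T / 2, where \<open>(?T n - ?R)\<^sup>2 / 2\<close>
      equals \<open>?L / 4\<close>, with \<open>?L / 2\<close> added to both sides. One \<rho>
      absorbs the factor \<open>gauss_tail_const * ?T n\<close>, the other the convergence of the
      tail exponent.\<close>
    have q_lower: "?L / 4 - ?q \<le> ?L * (1 / 2 + \<tau> + 2 * \<rho>)"
    proof -
      have "exp (- (?T n - ?R)\<^sup>2 / 2) * exp (- ?q) \<le> exp (- (?T n - ?R)\<^sup>2 / 2) * measure (G n) {\<mu>. ?R \<le> \<bar>\<mu>\<bar>}"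
        using tail_ge[OF n1 R] by (simp add: y_def)
      also have "\<dots> \<le> gauss_tail_const * ?T n * noisy_tail G n"
        using elim(5) by (intro noisy_tail_ge Gn.real_distribution_axioms) auto
      also have "\<dots> = exp (ln (gauss_tail_const * ?T n) + tail_exponent G n 1 * ?L)"
        using elim(3,5) n1 gauss_tail_const_pos by (simp add: exp_add powr_def)
      finally have "- (?T n - ?R)\<^sup>2 / 2 - ?q \<le> ln (gauss_tail_const * ?T n) + tail_exponent G n 1 * ?L"
        by (simp add: exp_add[symmetric])
      also have "\<dots> \<le> \<rho> * ?L + (\<tau> + \<rho>) * ?L"
        using elim(2,4) L by (intro add_mono mult_right_mono) auto
      finally have "- (?T n - ?R)\<^sup>2 / 2 - ?q \<le> \<rho> * ?L + (\<tau> + \<rho>) * ?L" .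
      moreover have "(?T n - ?R)\<^sup>2 = ?L / 2" using Tsq by (simp add: power2_eq_square field_simps)
      ultimately show ?thesis by (simp add: algebra_simps)
    qed
    have e_ge: "1 / (2 * K) \<le> e" using \<rho> K(2) by (simp add: e_def)
    have exponent: "(?R * (i + 1) / K)\<^sup>2 / 2 - Q (?R * i / K / \<sigma> n) \<le> e * ?L" if i: "i \<in> {1..<K}" for i
    proof -
      define s where "s = real i / real K"
      have s: "0 < s" "s \<le> 1" using i by (auto simp: s_def)
      \<comment> \<open>Replacing the outer edge (i + 1) / K by the inner edge s raises the square
        by at most 2 / K.\<close>
      have "real (2 * i + 1) / (real K)\<^sup>2 \<le> real (2 * K) / (real K)\<^sup>2"
        using i by (intro divide_right_mono) (auto simp del: of_nat_mult of_nat_add)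
      also have "\<dots> = 2 / K" by (simp add: power2_eq_square)
      finally have "((real i + 1) / K)\<^sup>2 \<le> s\<^sup>2 + 2 / K"
        by (simp add: s_def power_divide add_divide_distrib[symmetric] power2_sum algebra_simps)
          (simp add: add_divide_distrib)
      then have "?L / 4 * ((real i + 1) / K)\<^sup>2 \<le> ?L / 4 * (s\<^sup>2 + 2 / K)"
        using L by (intro mult_left_mono) auto
      moreover have "(?R * (i + 1) / K)\<^sup>2 / 2 = ?L / 4 * ((real i + 1) / K)\<^sup>2"
        using Tsq by (simp add: power_mult_distrib power_divide)
      ultimately have A: "(?R * (i + 1) / K)\<^sup>2 / 2 \<le> s\<^sup>2 * (?L / 4) + ?L * (1 / (2 * K))"
        by (simp add: algebra_simps)
      have "(1 - \<eta>) * s powr \<gamma> * ?q \<le> Q (s * y n)" using elim(1) i by (simp add: s_def)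
      also have "s * y n = ?R * i / K / \<sigma> n" by (simp add: s_def y_def ac_simps)
      finally have B: "s powr \<gamma> * ((1 - \<eta>) * ?q) \<le> Q (?R * i / K / \<sigma> n)" by (simp add: ac_simps)
      have C: "s\<^sup>2 * (?L / 4) - s powr \<gamma> * ((1 - \<eta>) * ?q) \<le> max 0 (?L / 4 - (1 - \<eta>) * ?q)"
        using L by (intro scaled_exponent_le s \<gamma>0 \<gamma>) simp
      have D: "max 0 (?L / 4 - (1 - \<eta>) * ?q) \<le> ?L * (e - \<rho> / 2)"
      proof (cases "?L / 4 \<le> (1 - \<eta>) * ?q")
        case True
        then show ?thesis using L \<rho> by (simp add: e_def)
      next
        case False
        have "0 < ?q" using R \<sigma>[OF n1] by (intro Qpos) (simp add: y_def)
        \<comment> \<open>When the end-point exponent is positive, \<open>?q\<close> is at most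
          \<open>?L / 2\<close>, so the error \<open>\<eta> * ?q\<close> is a small multiple of
          \<open>?L\<close>.\<close>
        then have "1 / 2 * ?q \<le> (1 - \<eta>) * ?q" using \<eta> by (intro mult_right_mono) auto
        with False have "?q \<le> ?L / 2" by simp
        then have "\<eta> * ?q \<le> \<rho> * (?L / 2)" using \<eta> L \<open>0 < ?q\<close> by (intro mult_mono) auto
        then have "?L / 4 - (1 - \<eta>) * ?q \<le> ?L * (1 / 2 + \<tau> + 2 * \<rho>) + \<rho> * (?L / 2)"
          using q_lower by (simp add: algebra_simps)
        also have "\<dots> = ?L * (1 / 2 + \<tau> + 5 / 2 * \<rho>)" by (simp add: algebra_simps)
        also have "\<dots> \<le> ?L * (e - \<rho> / 2)"
          using L \<rho> by (intro mult_left_mono) (auto simp: e_def)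
        finally show ?thesis using False by simp
      qed
      have E: "?L * (1 / (2 * K)) \<le> ?L * (\<rho> / 2)"
        using K(2) L by (intro mult_left_mono) auto
      from A B C D E show ?thesis by (simp add: algebra_simps)
    qed
    have term0: "exp ((?R / K)\<^sup>2 / 2) \<le> real n powr e"
    proof -
      have "(?R / K)\<^sup>2 / 2 = ?L * (1 / (4 * (real K)\<^sup>2))"
        using Tsq by (simp add: power_divide)
      also have "\<dots> \<le> ?L * e"
      proof (intro mult_left_mono)
        have "1 / (4 * (real K)\<^sup>2) \<le> 1 / (2 * real K)"
          using K(1) by (intro divide_left_mono) (auto simp: power2_eq_square)
        with e_ge show "1 / (4 * (real K)\<^sup>2) \<le> e" by simp
      qed (use L in simp)
      finally show ?thesis using n1 by (simp add: powr_def mult.commute)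
    qed
    have ind: "integrable (G n) (\<lambda>\<mu>. c * indicator {\<mu>. d < \<bar>\<mu>\<bar>} \<mu>)" for c d :: real
      by (simp add: Gn.emeasure_eq_measure)
    then have int: "integrable (G n) (\<lambda>\<mu>. \<Sum>i=1..<K. exp ((?R * (i + 1) / K)\<^sup>2 / 2) * indicator {\<mu>. ?R * i / K < \<bar>\<mu>\<bar>} \<mu>)"
      by (intro Bochner_Integration.integrable_sum)
    have "(\<integral>\<^sup>+\<mu>. ennreal (exp (\<mu>\<^sup>2 / 2)) * indicator {-?T n / 2..?T n / 2} \<mu> \<partial>G n) \<le>
        (\<integral>\<^sup>+\<mu>. ennreal (exp ((?R / K)\<^sup>2 / 2) +
          (\<Sum>i=1..<K. exp ((?R * (i + 1) / K)\<^sup>2 / 2) * indicator {\<mu>. ?R * i / K < \<bar>\<mu>\<bar>} \<mu>)) \<partial>G n)"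
      using grid_bound[OF K(1) R] by (intro nn_integral_mono) (auto split: split_indicator intro!: ennreal_leI)
    also have "\<dots> = ennreal (\<integral>\<mu>. exp ((?R / K)\<^sup>2 / 2) +
          (\<Sum>i=1..<K. exp ((?R * (i + 1) / K)\<^sup>2 / 2) * indicator {\<mu>. ?R * i / K < \<bar>\<mu>\<bar>} \<mu>) \<partial>G n)"
      using int by (intro nn_integral_eq_integral Bochner_Integration.integrable_add AE_I2 add_nonneg_nonneg sum_nonneg) auto
    also have "(\<integral>\<mu>. exp ((?R / K)\<^sup>2 / 2) +
          (\<Sum>i=1..<K. exp ((?R * (i + 1) / K)\<^sup>2 / 2) * indicator {\<mu>. ?R * i / K < \<bar>\<mu>\<bar>} \<mu>) \<partial>G n) =
        exp ((?R / K)\<^sup>2 / 2) + (\<Sum>i=1..<K. exp ((?R * (i + 1) / K)\<^sup>2 / 2) * measure (G n) {\<mu>. ?R * i / K < \<bar>\<mu>\<bar>})"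
      by (subst Bochner_Integration.integral_add[OF _ int], simp, subst Bochner_Integration.integral_sum[OF ind])
        (simp add: Gn.prob_space[simplified])
    also have "\<dots> \<le> real n powr e + (\<Sum>i=1..<K. 2 * real n powr e)"
    proof (intro add_mono sum_mono term0)
      fix i assume i: "i \<in> {1..<K}"
      have "exp ((?R * (i + 1) / K)\<^sup>2 / 2) * measure (G n) {\<mu>. ?R * i / K < \<bar>\<mu>\<bar>} \<le>
          exp ((?R * (i + 1) / K)\<^sup>2 / 2) * (2 * exp (- Q (?R * i / K / \<sigma> n)))"
        using i R by (intro mult_left_mono tail_le[OF n1]) auto
      also have "\<dots> = 2 * exp ((?R * (i + 1) / K)\<^sup>2 / 2 - Q (?R * i / K / \<sigma> n))"
        by (simp add: exp_diff exp_minus field_simps)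
      also have "\<dots> \<le> 2 * real n powr e"
        using exponent[OF i] n1 by (simp add: powr_def)
      finally show "exp ((?R * (i + 1) / K)\<^sup>2 / 2) * measure (G n) {\<mu>. ?R * i / K < \<bar>\<mu>\<bar>} \<le> 2 * real n powr e" .
    qed
    \<comment> \<open>The innermost cell counts once and each of the other \<open>K - 1\<close>
      twice, fewer than \<open>2 * K\<close> in total.\<close>
    also have "\<dots> \<le> J n"
      using K(1) by (simp add: J_def of_nat_diff algebra_simps)
    finally show ?case by (simp add: ennreal_leI)
  qed
  moreover have "(\<lambda>n. real n powr (1 / 2 - \<beta>) * J n) \<longlonglongrightarrow> 0"
    unfolding J_def e_def using \<rho>(1) K(1) by real_asymp
  ultimately show False
    using not_separable_level[OF G \<tau>, of \<beta> J] \<beta> \<beta>_gt by (simp add: J_def)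
qed

section \<open>From the critical level to a separable level\<close>

lemma separable_level_gt:
  assumes "c < lower_critical G" "0 \<le> c"
  obtains \<beta> where "\<beta> \<in> separable_levels G" "c < \<beta>"
proof -
  \<comment> \<open>As 0 \<le> c, the value 0 assigned to an empty set of levels is
    excluded.\<close>
  have "separable_levels G \<noteq> {}" "c < Sup (separable_levels G)"
    using assms by (auto simp: lower_critical_def split: if_splits)
  then obtain \<beta> where "\<beta> \<in> separable_levels G" "c < \<beta>" by (blast elim: less_cSupE)
  then show ?thesis by (rule that)
qed

theorem theorem1:
  fixes G :: "nat \<Rightarrow> real measure" and \<beta>s :: real
  assumes "\<And>n. n \<ge> 1 \<Longrightarrow> real_distribution (G n)"
    and "uniformly_convergent_on {0..1} (tail_exponent G)"
    and "critical_sparsity_level G \<beta>s"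
    and "\<beta>s > 3 / 4 \<or>
      (\<exists>F \<sigma> Q \<gamma>. scale_family G F \<sigma> \<and> (\<forall>\<theta>>0. ereal (Q \<theta>) = neg_log_tail F \<theta>) \<and>
         regularly_varying Q \<and> regular_variation_index Q \<gamma> \<and> \<gamma> \<le> 2)"
    and "\<beta>s > 1 / 2"
  shows "\<forall>\<alpha> \<beta>. 0 < \<alpha> \<and> \<alpha> < 1 \<and> 0 < \<beta> \<and> \<beta> < 1 \<and> \<beta> < \<beta>s \<longrightarrow>
    (\<lambda>n. max_test_power G \<beta> n \<alpha>) \<longlonglongrightarrow> 1"
proof (intro allI impI, elim conjE)
  fix \<alpha> \<beta> :: real
  assume \<alpha>: "0 < \<alpha>" "\<alpha> < 1" and \<beta>: "0 < \<beta>" "\<beta> < \<beta>s"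
  have G: "\<forall>n\<ge>1. real_distribution (G n)" using assms(1) by blast
  obtain l where "uniform_limit {0..1} (tail_exponent G) l sequentially"
    using assms(2) by (auto simp: uniformly_convergent_on_def)
  then have \<tau>: "(\<lambda>n. tail_exponent G n 1) \<longlonglongrightarrow> l 1"
    by (rule tendsto_uniform_limitI) simp
  have crit: "lower_critical G = \<beta>s"
    using assms(3) by (simp add: critical_sparsity_level_def)
  from assms(4) have "\<exists>\<beta>'>\<beta>. \<beta>' \<le> 1 + l 1"
  proof
    assume "\<beta>s > 3 / 4"
    \<comment> \<open>The maximum yields a separable level that lies above \<beta> and also in the
      range where it is bounded by 1 + \<tau>.\<close>
    then have "max (3 / 4) \<beta> < lower_critical G" using \<beta> crit by simp
    then obtain \<beta>' where "\<beta>' \<in> separable_levels G" "max (3 / 4) \<beta> < \<beta>'"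
      by (rule separable_level_gt) simp
    then show ?thesis using separable_level_le_dense[OF G \<tau>, of \<beta>'] by auto
  next
    assume "\<exists>F \<sigma> Q \<gamma>. scale_family G F \<sigma> \<and> (\<forall>\<theta>>0. ereal (Q \<theta>) = neg_log_tail F \<theta>) \<and>
         regularly_varying Q \<and> regular_variation_index Q \<gamma> \<and> \<gamma> \<le> 2"
    then obtain F \<sigma> Q \<gamma> where A: "scale_family G F \<sigma>" "\<forall>\<theta>>0. ereal (Q \<theta>) = neg_log_tail F \<theta>"
        "regularly_varying Q" "regular_variation_index Q \<gamma>" "\<gamma> \<le> 2"
      by blast
    have "max (1 / 2) \<beta> < lower_critical G" using \<beta> crit assms(5) by simp
    then obtain \<beta>' where "\<beta>' \<in> separable_levels G" "max (1 / 2) \<beta> < \<beta>'"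
      by (rule separable_level_gt) simp
    then show ?thesis using separable_level_le_scale[OF G \<tau> _ _ A, of \<beta>'] by auto
  qed
  then have "\<beta> < 1 + l 1" by auto
  with \<alpha> \<beta>(1) show "(\<lambda>n. max_test_power G \<beta> n \<alpha>) \<longlonglongrightarrow> 1"
    by (intro max_test_power_tendsto_1[OF G \<tau>]) auto
qed

end
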